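(* Let $(X,d)$ be a finite metric space with counting measure $\mu_X=\sum_{x\in X}\delta_x$. Then there is a weak equivalence of filtrations indexed by $(m,r)\in\,]0,\infty[^{op}\times[0,\infty[$ (after geometric realization) $$\mathcal{MD}(X,\mu_X)_{m,r/2}\;\simeq\;\mathcal S(\mathcal I(X)_r)_m .$$
   Context: An abstract simplicial complex is a set of finite non-empty sets closed under passing to non-empty subsets. Measure Dowker bifiltration: $\mathcal{MD}(X,\mu_X)_{m,r}$ is the simplicial complex of all non-empty $\sigma\subseteq X$ with $\mu_X(\{y\in X: d(x,y)\le 2r\ \text{for all }x\in\sigma\})\ge m$. Intrinsic Čech complex: $\mathcal I(X)_r$ is the simplicial complex of all non-empty $\sigma\subseteq X$ for which there is $y\in X$ with $d(x,y)\le r$ for all $x\in\sigma$. Subdivision filtration: for a simplicial complex $K$ with barycentric subdivision $\mathrm{Sd}(K)$ (simplices are flags $\sigma_0\subsetneq\dots\subsetneq\sigma_k$ of simplices of $K$), $\mathcal S(K)_m\subseteq\mathrm{Sd}(K)$ is the subcomplex of all flags with $\dim\sigma_0\ge m-1$. $]0,\infty[^{op}$ is the set of positive reals with reversed order. $\mathbf{Top}$ is the category of compactly generated weakly Hausdorff spaces. Two filtrations $F,F':P\to\mathbf{Top}$ indexed by a poset $P$ (functors sending all morphisms to inclusions) are weakly equivalent if they are connected by a finite zig-zag, through filtrations, of natural transformations all of whose components are homotopy equivalences. *)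

theory Defs
  imports "HOL-Analysis.Analysis"
begin

section \<open>Abstract simplicial complexes\<close>

definition abstract_complex :: "'v set set \<Rightarrow> bool" where
  "abstract_complex K \<longleftrightarrow>
     (\<forall>\<sigma>\<in>K. finite \<sigma> \<and> \<sigma> \<noteq> {}) \<and> (\<forall>\<sigma>\<in>K. \<forall>\<tau>. \<tau> \<noteq> {} \<and> \<tau> \<subseteq> \<sigma> \<longrightarrow> \<tau> \<in> K)"

definition simplex_dim :: "'v set \<Rightarrow> int" where
  "simplex_dim \<sigma> = int (card \<sigma>) - 1"

definition barycentric_subdivision :: "'v set set \<Rightarrow> 'v set set set" where
  "barycentric_subdivision K = {C \<in> chains K. finite C \<and> C \<noteq> {}}"

text \<open>For a flag \<open>C\<close>, i.e. a finite non-empty chain, \<open>\<Inter>C\<close> is its least member.\<close>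

definition subdivision_filtration :: "'v set set \<Rightarrow> real \<Rightarrow> 'v set set set" where
  "subdivision_filtration K m =
     {C \<in> barycentric_subdivision K. of_int (simplex_dim (\<Inter>C)) \<ge> m - 1}"

definition measure_dowker ::
    "'a set \<Rightarrow> ('a \<Rightarrow> 'a \<Rightarrow> real) \<Rightarrow> 'a measure \<Rightarrow> real \<Rightarrow> real \<Rightarrow> 'a set set" where
  "measure_dowker X d \<mu> m r =
     {\<sigma>. \<sigma> \<subseteq> X \<and> finite \<sigma> \<and> \<sigma> \<noteq> {} \<and>
          emeasure \<mu> {y \<in> X. \<forall>x\<in>\<sigma>. d x y \<le> 2 * r} \<ge> ennreal m}"

definition intrinsic_cech :: "'a set \<Rightarrow> ('a \<Rightarrow> 'a \<Rightarrow> real) \<Rightarrow> real \<Rightarrow> 'a set set" where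
  "intrinsic_cech X d r =
     {\<sigma>. \<sigma> \<subseteq> X \<and> finite \<sigma> \<and> \<sigma> \<noteq> {} \<and> (\<exists>y\<in>X. \<forall>x\<in>\<sigma>. d x y \<le> r)}"

lemma abstract_complex_intrinsic_cech: "abstract_complex (intrinsic_cech X d r)"
  unfolding abstract_complex_def intrinsic_cech_def
  by (auto dest: finite_subset)

lemma abstract_complex_measure_dowker:
  assumes "\<And>x r. x \<in> X \<Longrightarrow> {y \<in> X. d x y \<le> r} \<in> sets \<mu>"
  shows "abstract_complex (measure_dowker X d \<mu> m r)"
proof -
  have meas: "{y \<in> X. \<forall>x\<in>\<sigma>. d x y \<le> 2 * r} \<in> sets \<mu>"
    if "\<sigma> \<subseteq> X" "finite \<sigma>" "\<sigma> \<noteq> {}" for \<sigma>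
  proof -
    have "(\<Inter>x\<in>\<sigma>. {y \<in> X. d x y \<le> 2 * r}) \<in> sets \<mu>"
      using that assms by (intro sets.finite_INT) auto
    moreover have "(\<Inter>x\<in>\<sigma>. {y \<in> X. d x y \<le> 2 * r}) = {y \<in> X. \<forall>x\<in>\<sigma>. d x y \<le> 2 * r}"
      using that by auto
    ultimately show ?thesis by simp
  qed
  have "\<tau> \<in> measure_dowker X d \<mu> m r"
    if \<sigma>: "\<sigma> \<in> measure_dowker X d \<mu> m r" and \<tau>: "\<tau> \<noteq> {}" "\<tau> \<subseteq> \<sigma>" for \<sigma> \<tau>
  proof -
    have \<tau>': "\<tau> \<subseteq> X" "finite \<tau>"
      using \<sigma> \<tau> unfolding measure_dowker_def by (auto dest: finite_subset)
    have "emeasure \<mu> {y \<in> X. \<forall>x\<in>\<sigma>. d x y \<le> 2 * r} \<le> emeasure \<mu> {y \<in> X. \<forall>x\<in>\<tau>. d x y \<le> 2 * r}"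
      using \<tau> \<tau>' by (intro emeasure_mono meas) auto
    then show ?thesis
      using \<sigma> \<tau> \<tau>' unfolding measure_dowker_def by auto
  qed
  then show ?thesis
    unfolding abstract_complex_def measure_dowker_def by blast
qed

lemma abstract_complex_subdivision_filtration:
  assumes "abstract_complex K"
  shows "abstract_complex (subdivision_filtration K m)"
proof -
  have "C' \<in> subdivision_filtration K m"
    if C: "C \<in> subdivision_filtration K m" and C': "C' \<noteq> {}" "C' \<subseteq> C" for C C'
  proof -
    have sub: "C' \<in> barycentric_subdivision K"
    proof -
      have "C \<subseteq> K" "finite C" and ch: "\<And>A B. A \<in> C \<Longrightarrow> B \<in> C \<Longrightarrow> A \<subseteq> B \<or> B \<subseteq> A"
        using C unfolding subdivision_filtration_def barycentric_subdivision_def chains_def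
          chain_subset_def by auto
      moreover have "\<forall>A\<in>C'. \<forall>B\<in>C'. A \<subseteq> B \<or> B \<subseteq> A"
        using ch C'(2) by (meson subsetD)
      ultimately show ?thesis
        using C' finite_subset[of C' C]
        unfolding barycentric_subdivision_def chains_def chain_subset_def by simp
    qed
    obtain \<sigma> where "\<sigma> \<in> C'" using C' by auto
    moreover have "C' \<subseteq> K"
      using sub unfolding barycentric_subdivision_def chains_def by auto
    ultimately have "finite (\<Inter>C')"
      using assms unfolding abstract_complex_def by (auto intro: finite_subset[OF Inter_lower])
    then have "card (\<Inter>C) \<le> card (\<Inter>C')"
      using C' by (intro card_mono) auto
    then show ?thesis
      using C sub unfolding subdivision_filtration_def simplex_dim_def by auto
  qed
  then show ?thesis
    unfolding abstract_complex_def subdivision_filtration_def barycentric_subdivision_def by blast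
qed


section \<open>Geometric realization\<close>

text \<open>
  Points are barycentric coordinates. The topology is the coherent (weak) one: a set is open
  iff its trace on every closed simplex is open; closed simplices carry the Euclidean topology.
\<close>

definition realization_points :: "'v set set \<Rightarrow> ('v \<Rightarrow> real) set" where
  "realization_points K =
     {\<alpha>. (\<forall>v. 0 \<le> \<alpha> v) \<and> {v. \<alpha> v \<noteq> 0} \<in> K \<and> (\<Sum>v | \<alpha> v \<noteq> 0. \<alpha> v) = 1}"

definition closed_simplex :: "'v set set \<Rightarrow> 'v set \<Rightarrow> ('v \<Rightarrow> real) set" where
  "closed_simplex K \<sigma> = {\<alpha> \<in> realization_points K. {v. \<alpha> v \<noteq> 0} \<subseteq> \<sigma>}"

definition realization :: "'v set set \<Rightarrow> ('v \<Rightarrow> real) topology" where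
  "realization K = topology (\<lambda>U. U \<subseteq> realization_points K \<and>
     (\<forall>\<sigma>\<in>K. openin (subtopology (powertop_real UNIV) (closed_simplex K \<sigma>))
                   (U \<inter> closed_simplex K \<sigma>)))"

lemma openin_realization:
  "openin (realization K) U \<longleftrightarrow> U \<subseteq> realization_points K \<and>
     (\<forall>\<sigma>\<in>K. openin (subtopology (powertop_real UNIV) (closed_simplex K \<sigma>))
                   (U \<inter> closed_simplex K \<sigma>))"
proof -
  let ?L = "\<lambda>U. U \<subseteq> realization_points K \<and>
     (\<forall>\<sigma>\<in>K. openin (subtopology (powertop_real UNIV) (closed_simplex K \<sigma>))
                   (U \<inter> closed_simplex K \<sigma>))"
  have "istopology ?L"
    unfolding istopology_def
  proof (intro conjI allI impI ballI)
    fix S T \<sigma> assume "?L S" "?L T" "\<sigma> \<in> K"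
    then have "openin (subtopology (powertop_real UNIV) (closed_simplex K \<sigma>))
                 ((S \<inter> closed_simplex K \<sigma>) \<inter> (T \<inter> closed_simplex K \<sigma>))"
      by (intro openin_Int[of _ "S \<inter> closed_simplex K \<sigma>"]) simp_all
    moreover have "(S \<inter> closed_simplex K \<sigma>) \<inter> (T \<inter> closed_simplex K \<sigma>) = S \<inter> T \<inter> closed_simplex K \<sigma>"
      by blast
    ultimately show "openin (subtopology (powertop_real UNIV) (closed_simplex K \<sigma>))
                 (S \<inter> T \<inter> closed_simplex K \<sigma>)"
      by (simp only:)
  next
    fix \<U> \<sigma> assume U: "\<forall>U\<in>\<U>. ?L U" "\<sigma> \<in> K"
    have "openin (subtopology (powertop_real UNIV) (closed_simplex K \<sigma>))
            (\<Union>U\<in>\<U>. U \<inter> closed_simplex K \<sigma>)"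
    proof (rule openin_Union)
      fix V assume "V \<in> (\<lambda>U. U \<inter> closed_simplex K \<sigma>) ` \<U>"
      then obtain U where "U \<in> \<U>" "V = U \<inter> closed_simplex K \<sigma>" by (rule imageE)
      then show "openin (subtopology (powertop_real UNIV) (closed_simplex K \<sigma>)) V"
        using U by simp
    qed
    moreover have "\<Union>\<U> \<inter> closed_simplex K \<sigma> = (\<Union>U\<in>\<U>. U \<inter> closed_simplex K \<sigma>)"
      by blast
    ultimately show "openin (subtopology (powertop_real UNIV) (closed_simplex K \<sigma>))
                 (\<Union>\<U> \<inter> closed_simplex K \<sigma>)"
      by (simp only:)
  qed auto
  then show ?thesis
    unfolding realization_def by (simp add: topology_inverse')
qed

lemma topspace_realization: "topspace (realization K) = realization_points K"
proof (rule subset_antisym)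
  show "topspace (realization K) \<subseteq> realization_points K"
    using openin_topspace[of "realization K"] unfolding openin_realization by (rule conjunct1)
  have "openin (realization K) (realization_points K)"
    unfolding openin_realization
  proof (intro conjI ballI)
    fix \<sigma> assume "\<sigma> \<in> K"
    have "realization_points K \<inter> closed_simplex K \<sigma> =
          topspace (subtopology (powertop_real UNIV) (closed_simplex K \<sigma>))"
      unfolding closed_simplex_def by auto
    then show "openin (subtopology (powertop_real UNIV) (closed_simplex K \<sigma>))
                 (realization_points K \<inter> closed_simplex K \<sigma>)"
      by (simp only: openin_topspace)
  qed simp
  then show "realization_points K \<subseteq> topspace (realization K)"
    by (rule openin_subset)
qed


section \<open>Filtrations and weak equivalence\<close>

text \<open>
  The test objects are all compact Hausdorff spaces; quantifying over those on the type
  \<open>'a set set\<close> loses nothing. If \<open>f : T \<rightarrow> X\<close> has non-closed image, replace \<open>T\<close> by the closure of a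
  set of representatives of the fibres: it has the same image, and it has at most
  \<open>2^(2^|X|)\<close> points because \<open>T\<close> is Hausdorff. Given the weak Hausdorff condition, images of
  compact Hausdorff spaces are compact Hausdorff quotients, so the second condition can be
  tested on subspaces of \<open>X\<close>.
\<close>

definition cgwh_space :: "'a topology \<Rightarrow> bool" where
  "cgwh_space X \<longleftrightarrow>
     (\<forall>(T :: 'a set set topology) f.
        compact_space T \<and> Hausdorff_space T \<and> continuous_map T X f
        \<longrightarrow> closedin X (f ` topspace T)) \<and>
     (\<forall>A \<subseteq> topspace X.
        (\<forall>(T :: 'a set set topology) f.
           compact_space T \<and> Hausdorff_space T \<and> continuous_map T X f
           \<longrightarrow> closedin T {t \<in> topspace T. f t \<in> A})
        \<longrightarrow> closedin X A)"

text \<open>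
  A poset is a carrier \<open>P\<close> with an order relation \<open>R\<close>. Since the structure maps of a filtration
  are inclusions, the functor is determined by its values on objects.
\<close>

definition filtration :: "'p set \<Rightarrow> ('p \<times> 'p) set \<Rightarrow> ('p \<Rightarrow> 'a topology) \<Rightarrow> bool" where
  "filtration P R F \<longleftrightarrow>
     partial_order_on P R \<and> (\<forall>p\<in>P. cgwh_space (F p)) \<and>
     (\<forall>(p, q)\<in>R. topspace (F p) \<subseteq> topspace (F q) \<and> F p = subtopology (F q) (topspace (F p)))"

definition homotopy_equivalence :: "'a topology \<Rightarrow> 'b topology \<Rightarrow> ('a \<Rightarrow> 'b) \<Rightarrow> bool" where
  "homotopy_equivalence X Y f \<longleftrightarrow> continuous_map X Y f \<and>
     (\<exists>g. continuous_map Y X g \<and>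
          homotopic_with (\<lambda>_. True) X X (g \<circ> f) id \<and>
          homotopic_with (\<lambda>_. True) Y Y (f \<circ> g) id)"

definition natural_transformation ::
    "'p set \<Rightarrow> ('p \<times> 'p) set \<Rightarrow> ('p \<Rightarrow> 'a topology) \<Rightarrow> ('p \<Rightarrow> 'b topology) \<Rightarrow> ('p \<Rightarrow> 'a \<Rightarrow> 'b) \<Rightarrow> bool" where
  "natural_transformation P R F G \<eta> \<longleftrightarrow>
     (\<forall>p\<in>P. continuous_map (F p) (G p) (\<eta> p)) \<and>
     (\<forall>(p, q)\<in>R. \<forall>x\<in>topspace (F p). \<eta> q x = \<eta> p x)"

definition pointwise_equivalence ::
    "'p set \<Rightarrow> ('p \<times> 'p) set \<Rightarrow> ('p \<Rightarrow> 'a topology) \<Rightarrow> ('p \<Rightarrow> 'b topology) \<Rightarrow> bool" where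
  "pointwise_equivalence P R F G \<longleftrightarrow>
     filtration P R F \<and> filtration P R G \<and>
     (\<exists>\<eta>. natural_transformation P R F G \<eta> \<and> (\<forall>p\<in>P. homotopy_equivalence (F p) (G p) (\<eta> p)))"

definition zigzag_step ::
    "'p set \<Rightarrow> ('p \<times> 'p) set \<Rightarrow> ('p \<Rightarrow> 'a topology) \<Rightarrow> ('p \<Rightarrow> 'b topology) \<Rightarrow> bool" where
  "zigzag_step P R F G \<longleftrightarrow> pointwise_equivalence P R F G \<or> pointwise_equivalence P R G F"

text \<open>
  The endpoints \<open>F\<close> and \<open>G\<close> may live on different types. HOL cannot quantify existentially over
  types, so the type \<open>'u\<close> carrying the intermediate filtrations of the zig-zag is an explicit
  parameter. Whatever \<open>'u\<close> is, such a zig-zag is a zig-zag in the unrestricted sense, so fixing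
  \<open>'u\<close> in an assertion of weak equivalence can only make that assertion stronger.
\<close>

definition weakly_equivalent ::
    "'u itself \<Rightarrow> 'p set \<Rightarrow> ('p \<times> 'p) set \<Rightarrow> ('p \<Rightarrow> 'a topology) \<Rightarrow> ('p \<Rightarrow> 'b topology) \<Rightarrow> bool" where
  "weakly_equivalent (_ :: 'u itself) P R F G \<longleftrightarrow>
     zigzag_step P R F G \<or>
     (\<exists>A B :: 'p \<Rightarrow> 'u topology.
        zigzag_step P R F A \<and> (zigzag_step P R)\<^sup>*\<^sup>* A B \<and> zigzag_step P R B G)"


section \<open>The index poset\<close>

definition index_set :: "(real \<times> real) set" where
  "index_set = {0<..} \<times> {0..}"

definition index_order :: "((real \<times> real) \<times> (real \<times> real)) set" where
  "index_order =
     {((m, r), (m', r')). (m, r) \<in> index_set \<and> (m', r') \<in> index_set \<and> m' \<le> m \<and> r \<le> r'}"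

lemma partial_order_on_index: "partial_order_on index_set index_order"
  unfolding partial_order_on_def preorder_on_def refl_on_def trans_def antisym_def
    index_order_def index_set_def
  by auto

end

theory Submission
  imports Defs
begin

text \<open>
  For \<open>\<sigma> \<subseteq> X\<close> let \<open>N(\<sigma>)\<close> be the set of points of \<open>X\<close> within distance \<open>r\<close> of every point of \<open>\<sigma>\<close>.
  A simplex of the left-hand complex is a nonempty \<open>\<sigma>\<close> with \<open>m \<le> |N(\<sigma>)|\<close>, a vertex of the right-hand
  complex is a \<open>\<tau>\<close> with \<open>m \<le> |\<tau>|\<close> and \<open>N(\<tau>) \<noteq> {}\<close>. The classical form of Dowker duality would
  compare the two posets by the Galois connection \<open>N\<close>, but \<open>N\<close> depends on \<open>r\<close>, so it is not natural
  in the index. The remedy is the poset of all pairs \<open>(\<sigma>, \<tau>)\<close> of subsets of \<open>X\<close> with \<open>\<sigma>\<close> nonempty,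
  \<open>d \<le> r\<close> on \<open>\<sigma> \<times> \<tau>\<close> and \<open>m \<le> |\<tau>|\<close>, ordered by enlarging \<open>\<sigma>\<close> and shrinking \<open>\<tau>\<close>.
  Its two projections are the same for all \<open>m\<close> and \<open>r\<close>. Only their homotopy inverses, induced by
  \<open>\<sigma> \<mapsto> (\<sigma>, N(\<sigma>))\<close> and \<open>\<tau> \<mapsto> (N(\<tau>), \<tau>)\<close>, vary with \<open>r\<close>, and inverses need not be natural.
  Hence the order complexes of these posets form the middle term of a zig-zag with two arrows.

  Each projection has its inverse as a section, and the composite the other way moves every pair
  to a comparable one: \<open>(\<sigma>, N(\<sigma>)) \<le> (\<sigma>, \<tau>) \<le> (N(\<tau>), \<tau>)\<close>. So both are homotopy equivalences of order
  complexes, by \<open>vertex_retraction_homotopy_equivalence\<close>, whose substance is that an order-preserving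
  map below the identity is homotopic to it (\<open>homotopic_descent_map\<close>). The first projection lands in
  the barycentric subdivision of the measure Dowker complex rather than in the complex itself; the
  missing link is \<open>barycentric_subdivision_homotopy_equivalence\<close>.

  All complexes are finite, so their realizations are compact subspaces of a product of real lines.
  Maps into them are therefore given by formulas, and their continuity is checked one coordinate at a time.
\<close>

section \<open>Realizations of finite complexes\<close>

lemma abstract_complex_face:
  assumes "abstract_complex K" "\<sigma> \<in> K" "\<tau> \<subseteq> \<sigma>" "\<tau> \<noteq> {}"
  shows "\<tau> \<in> K"
  using assms unfolding abstract_complex_def by blast

definition finite_complex :: "'v set set \<Rightarrow> bool" where
  "finite_complex K \<longleftrightarrow> abstract_complex K \<and> finite K"

lemma finite_complex_vertices:
  assumes "finite_complex K"
  shows "finite (\<Union>K)"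
  using assms unfolding finite_complex_def abstract_complex_def by blast

lemma realization_points_sum:
  assumes "\<alpha> \<in> realization_points K" "finite V" "{v. \<alpha> v \<noteq> 0} \<subseteq> V"
  shows "sum \<alpha> V = 1"
proof -
  have "sum \<alpha> V = sum \<alpha> {v. \<alpha> v \<noteq> 0}"
    using assms by (intro sum.mono_neutral_right) auto
  then show ?thesis
    using assms by (simp add: realization_points_def)
qed

lemma realization_pointsI:
  assumes "abstract_complex K" "\<sigma> \<in> K" "{v. \<alpha> v \<noteq> 0} \<subseteq> \<sigma>"
    and "finite V" "{v. \<alpha> v \<noteq> 0} \<subseteq> V" "sum \<alpha> V = 1" "\<And>v. 0 \<le> \<alpha> v"
  shows "\<alpha> \<in> realization_points K"
proof -
  have eq: "sum \<alpha> V = sum \<alpha> {v. \<alpha> v \<noteq> 0}"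
    using assms by (intro sum.mono_neutral_right) auto
  then have "{v. \<alpha> v \<noteq> 0} \<noteq> {}"
    using assms(6) by (metis sum.empty zero_neq_one)
  then have "{v. \<alpha> v \<noteq> 0} \<in> K"
    by (rule abstract_complex_face[OF assms(1-3)])
  then show ?thesis
    unfolding realization_points_def using assms(6,7) eq by simp
qed

lemma realization_points_mono:
  assumes "K \<subseteq> L"
  shows "realization_points K \<subseteq> realization_points L"
  unfolding realization_points_def using assms by blast

lemma closed_closed_simplex:
  assumes "abstract_complex K" "\<sigma> \<in> K"
  shows "closed (closed_simplex K \<sigma>)"
proof -
  have fin: "finite \<sigma>"
    using assms by (auto simp: abstract_complex_def)
  have "closed_simplex K \<sigma> =
      (\<Inter>v. {\<alpha>. 0 \<le> \<alpha> v}) \<inter> (\<Inter>v\<in>-\<sigma>. {\<alpha>. \<alpha> v = 0}) \<inter> {\<alpha>. sum \<alpha> \<sigma> = 1}" (is "_ = ?R")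
  proof (intro subset_antisym subsetI)
    fix \<alpha> assume "\<alpha> \<in> closed_simplex K \<sigma>"
    then show "\<alpha> \<in> ?R"
      using realization_points_sum[of \<alpha> K \<sigma>] fin
      by (auto simp: closed_simplex_def realization_points_def)
  next
    fix \<alpha> assume a: "\<alpha> \<in> ?R"
    then have "{v. \<alpha> v \<noteq> 0} \<subseteq> \<sigma>" by auto
    then show "\<alpha> \<in> closed_simplex K \<sigma>"
      using a realization_pointsI[OF assms _ fin, of \<alpha>]
      by (auto simp: closed_simplex_def)
  qed
  moreover have "closed ?R"
    by (intro closed_Int closed_INT ballI closed_Collect_le closed_Collect_eq continuous_intros
          continuous_on_product_coordinates)
  ultimately show ?thesis by simp
qed

lemma realization_points_Union_simplices:
  "realization_points K = (\<Union>\<sigma>\<in>K. closed_simplex K \<sigma>)"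
proof (intro subset_antisym subsetI)
  fix \<alpha> assume "\<alpha> \<in> realization_points K"
  then have "{v. \<alpha> v \<noteq> 0} \<in> K" "\<alpha> \<in> closed_simplex K {v. \<alpha> v \<noteq> 0}"
    by (simp_all add: closed_simplex_def realization_points_def)
  then show "\<alpha> \<in> (\<Union>\<sigma>\<in>K. closed_simplex K \<sigma>)"
    by blast
qed (auto simp: closed_simplex_def)

text \<open>
  A finite complex is covered by finitely many closed simplices, each closed in the product; hence a
  set whose trace on every closed simplex is relatively closed is itself closed, and the coherent
  topology is no finer than the product topology.
\<close>

lemma realization_eq_top_of_set:
  assumes "finite_complex K"
  shows "realization K = top_of_set (realization_points K)"
proof (rule topology_eq[THEN iffD2], intro allI)
  fix U
  have K: "abstract_complex K" "finite K"
    using assms by (auto simp: finite_complex_def)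
  let ?P = "realization_points K"
  have sub: "closed_simplex K \<sigma> \<subseteq> ?P" for \<sigma>
    by (auto simp: closed_simplex_def)
  show "openin (realization K) U \<longleftrightarrow> openin (top_of_set ?P) U"
  proof
    assume U: "openin (realization K) U"
    have cl: "closed (closed_simplex K \<sigma> - U)" if "\<sigma> \<in> K" for \<sigma>
    proof -
      have "openin (top_of_set (closed_simplex K \<sigma>)) (U \<inter> closed_simplex K \<sigma>)"
        using U that by (simp add: openin_realization euclidean_product_topology)
      then have "closedin (top_of_set (closed_simplex K \<sigma>)) (closed_simplex K \<sigma> - U)"
        by (simp add: closedin_def Diff_Diff_Int Int_commute)
      then show ?thesis
        using closed_closed_simplex[OF K(1) that] closedin_closed_trans by blast
    qed
    have "?P - U = (\<Union>\<sigma>\<in>K. closed_simplex K \<sigma> - U)"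
      by (subst realization_points_Union_simplices) blast
    moreover have "closed (\<Union>\<sigma>\<in>K. closed_simplex K \<sigma> - U)"
      by (rule closed_UN) (use cl K(2) in blast)+
    ultimately have "closed (?P - U)"
      by (simp only:)
    then have "open (- (?P - U))"
      by (rule open_Compl)
    moreover have "U \<subseteq> ?P"
      using U by (simp add: openin_realization)
    then have "U = ?P \<inter> - (?P - U)"
      by blast
    ultimately show "openin (top_of_set ?P) U"
      unfolding openin_open by blast
  next
    assume U: "openin (top_of_set ?P) U"
    then have "openin (top_of_set (closed_simplex K \<sigma>)) (U \<inter> closed_simplex K \<sigma>)" for \<sigma>
      using sub[of \<sigma>] by (auto simp: openin_open)
    then show "openin (realization K) U"
      using U openin_subset[OF U] by (simp add: openin_realization euclidean_product_topology)
  qed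
qed

text \<open>
  Barycentric coordinates lie in \<open>[0, 1]\<close>, so the realization is a closed subset of a Tychonoff cube.
\<close>

lemma compact_realization_points:
  assumes "finite_complex K"
  shows "compact (realization_points K)"
proof -
  have K: "abstract_complex K" "finite K"
    using assms by (auto simp: finite_complex_def)
  have cl: "closed (realization_points K)"
    unfolding realization_points_Union_simplices
    by (rule closed_UN) (use K closed_closed_simplex in blast)+
  have "compactin (powertop_real UNIV) (\<Pi>\<^sub>E v\<in>UNIV. {0..1})"
    by (simp add: compactin_PiE)
  then have cp: "compact (\<Pi>\<^sub>E v\<in>UNIV. {0..1::real})"
    by (simp add: euclidean_product_topology)
  have "realization_points K \<subseteq> (\<Pi>\<^sub>E v\<in>UNIV. {0..1})"
  proof
    fix \<alpha> assume a: "\<alpha> \<in> realization_points K"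
    have fin: "finite {v. \<alpha> v \<noteq> 0}"
      using a K(1) by (auto simp: realization_points_def abstract_complex_def)
    have "\<alpha> v \<le> 1" for v
    proof (cases "\<alpha> v = 0")
      case False
      then have "\<alpha> v \<le> sum \<alpha> {v. \<alpha> v \<noteq> 0}"
        using a fin by (intro member_le_sum) (auto simp: realization_points_def)
      then show ?thesis
        using a by (simp add: realization_points_def)
    qed simp
    then show "\<alpha> \<in> (\<Pi>\<^sub>E v\<in>UNIV. {0..1})"
      using a by (auto simp: realization_points_def)
  qed
  then show ?thesis
    using compact_Int_closed[OF cp cl] by (simp add: Int_absorb1)
qed

text \<open>
  A compact Hausdorff space is its own test object. Test objects live on a different type, so the space is
  transported there along the injection \<open>x \<mapsto> {{x}}\<close>.
\<close>

lemma cgwh_space_compact_Hausdorff: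
  fixes X :: "'a topology"
  assumes "compact_space X" "Hausdorff_space X"
  shows "cgwh_space X"
  unfolding cgwh_space_def
proof (intro conjI allI impI)
  fix T :: "'a set set topology" and f
  assume T: "compact_space T \<and> Hausdorff_space T \<and> continuous_map T X f"
  then have "compactin X (f ` topspace T)"
    by (intro image_compactin[of T]) (auto simp: compact_space_def)
  then show "closedin X (f ` topspace T)"
    by (rule compactin_imp_closedin[OF assms(2)])
next
  fix A
  assume A: "A \<subseteq> topspace X" and test: "\<forall>(T :: 'a set set topology) f.
    compact_space T \<and> Hausdorff_space T \<and> continuous_map T X f
           \<longrightarrow> closedin T {t \<in> topspace T. f t \<in> A}"
  define e :: "'a \<Rightarrow> 'a set set" where "e x = {{x}}" for x
  define h :: "'a set set \<Rightarrow> 'a" where "h = inv e"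
  define T where "T = pullback_topology (range e) h X"
  have "inj e"
    by (simp add: e_def inj_def)
  then have he: "h (e x) = x" for x
    by (simp add: h_def)
  have top: "topspace T = e ` topspace X"
    by (auto simp: T_def topspace_pullback_topology he)
  have ch: "continuous_map T X h"
    unfolding T_def using continuous_map_pullback[OF continuous_map_id] by simp
  have ce: "continuous_map X T e"
    unfolding T_def by (rule continuous_map_pullback') (auto simp: o_def he)
  have hom: "homeomorphic_maps X T e h"
    using ce ch top by (auto simp: homeomorphic_maps_def he)
  then have "X homeomorphic_space T"
    by (auto simp: homeomorphic_space_def)
  then have "compact_space T" "Hausdorff_space T"
    using assms by (simp_all add: homeomorphic_compact_space[of X T] homeomorphic_Hausdorff_space[of X T])
  then have "closedin T {t \<in> topspace T. h t \<in> A}"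
    using test ch by blast
  then have "closedin X {x \<in> topspace X. e x \<in> {t \<in> topspace T. h t \<in> A}}"
    by (rule closedin_continuous_map_preimage[OF ce])
  moreover have "{x \<in> topspace X. e x \<in> {t \<in> topspace T. h t \<in> A}} = A"
    using A top by (auto simp: he)
  ultimately show "closedin X A" by simp
qed

lemma cgwh_space_realization:
  assumes "finite_complex K"
  shows "cgwh_space (realization K)"
proof (rule cgwh_space_compact_Hausdorff)
  show "compact_space (realization K)"
    using compact_realization_points[OF assms]
    by (simp add: realization_eq_top_of_set[OF assms] compact_space_subtopology)
  have "Hausdorff_space (euclidean :: ('a \<Rightarrow> real) topology)"
    unfolding euclidean_product_topology[symmetric]
    by (simp add: Hausdorff_space_product_topology)
  then show "Hausdorff_space (realization K)"
    by (simp add: realization_eq_top_of_set[OF assms] Hausdorff_space_subtopology)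
qed

lemma filtration_realization:
  assumes "partial_order_on P R" "\<And>p. p \<in> P \<Longrightarrow> finite_complex (K p)"
    and "\<And>p q. (p, q) \<in> R \<Longrightarrow> K p \<subseteq> K q"
  shows "filtration P R (\<lambda>p. realization (K p))"
  unfolding filtration_def
proof (intro conjI ballI)
  show "cgwh_space (realization (K p))" if "p \<in> P" for p
    using that assms(2) cgwh_space_realization by blast
next
  fix pq assume pq: "pq \<in> R"
  obtain p q where [simp]: "pq = (p, q)" by force
  have "p \<in> P" "q \<in> P"
    using pq assms(1) by (auto simp: partial_order_on_def preorder_on_def refl_on_def)
  then have f: "finite_complex (K p)" "finite_complex (K q)"
    using assms(2) by auto
  have "realization_points (K p) \<subseteq> realization_points (K q)"
    using assms(3) pq by (intro realization_points_mono) auto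
  then show "case pq of (p, q) \<Rightarrow> topspace (realization (K p)) \<subseteq> topspace (realization (K q)) \<and>
      realization (K p) = subtopology (realization (K q)) (topspace (realization (K p)))"
    by (simp add: topspace_realization realization_eq_top_of_set[OF f(1)]
        realization_eq_top_of_set[OF f(2)] subtopology_subtopology Int_absorb1)
qed (rule assms(1))

text \<open>
  The segment between two points of a common closed simplex stays in that simplex.
\<close>

lemma straight_line_homotopic:
  fixes f g :: "('u \<Rightarrow> real) \<Rightarrow> 'v \<Rightarrow> real"
  assumes J: "finite_complex J" and K: "finite_complex K"
    and f: "continuous_map (realization J) (realization K) f"
    and g: "continuous_map (realization J) (realization K) g"
    and carrier: "\<And>\<alpha>. \<alpha> \<in> realization_points J \<Longrightarrow>
      \<exists>\<sigma>\<in>K. {v. f \<alpha> v \<noteq> 0} \<subseteq> \<sigma> \<and> {v. g \<alpha> v \<noteq> 0} \<subseteq> \<sigma>"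
  shows "homotopic_with (\<lambda>_. True) (realization J) (realization K) f g"
proof -
  let ?h = "\<lambda>(t, y) v. (1 - t) * f y v + t * g y v"
  define S where "S = realization_points J"
  have fg: "continuous_on S f" "f ` S \<subseteq> realization_points K" "continuous_on S g" "g ` S \<subseteq> realization_points K"
    using f g by (auto simp: S_def realization_eq_top_of_set[OF J] realization_eq_top_of_set[OF K])
  have "?h (t, y) \<in> realization_points K" if ty: "t \<in> {0..1}" "y \<in> S" for t y
  proof -
    obtain \<sigma> where \<sigma>: "\<sigma> \<in> K" "{v. f y v \<noteq> 0} \<subseteq> \<sigma>" "{v. g y v \<noteq> 0} \<subseteq> \<sigma>"
      using carrier[of y] ty(2) unfolding S_def by blast
    have fin: "finite \<sigma>"
      using \<sigma>(1) K by (auto simp: finite_complex_def abstract_complex_def)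
    have pts: "f y \<in> realization_points K" "g y \<in> realization_points K"
      using fg ty by auto
    have supp: "{v. ?h (t, y) v \<noteq> 0} \<subseteq> \<sigma>"
    proof
      fix v assume "v \<in> {v. ?h (t, y) v \<noteq> 0}"
      then have "f y v \<noteq> 0 \<or> g y v \<noteq> 0" by auto
      then show "v \<in> \<sigma>" using \<sigma> by blast
    qed
    have "sum (?h (t, y)) \<sigma> = (1 - t) * sum (f y) \<sigma> + t * sum (g y) \<sigma>"
      by (simp add: sum.distrib sum_distrib_left)
    also have "\<dots> = 1"
      using realization_points_sum[OF _ fin] pts \<sigma> by simp
    finally show ?thesis
      using K \<sigma>(1) supp fin pts ty
      by (intro realization_pointsI[of K \<sigma> _ \<sigma>])
        (auto simp: finite_complex_def realization_points_def)
  qed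
  moreover have "continuous_on ({0..1} \<times> S) ?h"
  proof (rule continuous_on_coordinatewise_then_product)
    fix v
    have coord: "continuous_on ({0..1::real} \<times> S) (\<lambda>z. k (snd z) v)" if "continuous_on S k"
      for k :: "('u \<Rightarrow> real) \<Rightarrow> 'v \<Rightarrow> real"
    proof (rule continuous_on_compose2[where f = snd and g = "\<lambda>\<alpha>. k \<alpha> v"])
      show "continuous_on S (\<lambda>\<alpha>. k \<alpha> v)"
        using that by (rule continuous_on_product_then_coordinatewise)
    qed (auto intro: continuous_on_snd continuous_on_id)
    show "continuous_on ({0..1} \<times> S) (\<lambda>z. ?h z v)"
      unfolding case_prod_unfold
      by (intro continuous_on_add continuous_on_mult continuous_on_diff continuous_on_const
          continuous_on_fst continuous_on_id coord fg)
  qed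
  ultimately have "continuous_map (top_of_set ({0..1} \<times> S)) (realization K) ?h"
    by (auto simp: realization_eq_top_of_set[OF K])
  then show ?thesis
    by (subst homotopic_with) (auto simp: realization_eq_top_of_set[OF J] S_def intro!: exI[of _ ?h])
qed

section \<open>Piecewise affine maps\<close>

definition barycentre :: "'v set \<Rightarrow> 'v \<Rightarrow> real" where
  "barycentre \<sigma> v = (if v \<in> \<sigma> then 1 / real (card \<sigma>) else 0)"

text \<open>
  The affine extension of the assignment that sends a vertex \<open>v\<close> to the barycentre of the simplex
  \<open>F v\<close>. With singletons \<open>F v = {f v}\<close> it is the simplicial map induced by \<open>f\<close>; with the
  identity for \<open>F\<close> it is the comparison map from the barycentric subdivision of a complex to the complex.
\<close>

definition barycentric_map :: "('v \<Rightarrow> 'w set) \<Rightarrow> ('v \<Rightarrow> real) \<Rightarrow> 'w \<Rightarrow> real" where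
  "barycentric_map F \<alpha> w = (\<Sum>v | \<alpha> v \<noteq> 0. \<alpha> v * barycentre (F v) w)"

lemma barycentre_nonneg: "0 \<le> barycentre \<sigma> v"
  by (simp add: barycentre_def)

lemma barycentre_eq_0: "v \<notin> \<sigma> \<Longrightarrow> barycentre \<sigma> v = 0"
  by (simp add: barycentre_def)

lemma sum_barycentre:
  assumes "finite V" "\<sigma> \<subseteq> V" "\<sigma> \<noteq> {}"
  shows "sum (barycentre \<sigma>) V = 1"
proof -
  have fin: "finite \<sigma>"
    using assms finite_subset by blast
  have "sum (barycentre \<sigma>) V = sum (barycentre \<sigma>) \<sigma>"
    using assms by (intro sum.mono_neutral_right) (auto simp: barycentre_def)
  also have "\<dots> = 1"
    using fin assms(3) by (simp add: barycentre_def)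
  finally show ?thesis .
qed

lemma barycentric_map_eq_sum:
  assumes "finite V" "{v. \<alpha> v \<noteq> 0} \<subseteq> V"
  shows "barycentric_map F \<alpha> w = (\<Sum>v\<in>V. \<alpha> v * barycentre (F v) w)"
  unfolding barycentric_map_def using assms by (intro sum.mono_neutral_left) auto

lemma support_barycentric_map:
  "{w. barycentric_map F \<alpha> w \<noteq> 0} \<subseteq> \<Union>(F ` {v. \<alpha> v \<noteq> 0})"
proof
  fix w assume "w \<in> {w. barycentric_map F \<alpha> w \<noteq> 0}"
  then have "(\<Sum>v | \<alpha> v \<noteq> 0. \<alpha> v * barycentre (F v) w) \<noteq> 0"
    by (simp add: barycentric_map_def)
  then obtain v where "\<alpha> v \<noteq> 0" "barycentre (F v) w \<noteq> 0"
    by (metis (mono_tags, lifting) mem_Collect_eq mult_zero_right sum.neutral)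
  then show "w \<in> \<Union>(F ` {v. \<alpha> v \<noteq> 0})"
    by (auto simp: barycentre_def split: if_splits)
qed

lemma barycentric_map_in_realization_points:
  assumes K: "abstract_complex K" and L: "abstract_complex L"
    and F: "\<And>\<sigma>. \<sigma> \<in> K \<Longrightarrow> \<Union>(F ` \<sigma>) \<in> L" "\<And>v. v \<in> \<Union>K \<Longrightarrow> F v \<noteq> {}"
    and \<alpha>: "\<alpha> \<in> realization_points K"
  shows "barycentric_map F \<alpha> \<in> realization_points L"
proof -
  define S where "S = {v. \<alpha> v \<noteq> 0}"
  define W where "W = \<Union>(F ` S)"
  have S: "S \<in> K" "sum \<alpha> S = 1" and nonneg: "0 \<le> \<alpha> v" for v
    using \<alpha> by (simp_all add: realization_points_def S_def)
  have W: "W \<in> L"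
    using F(1) S(1) by (simp add: W_def)
  have finS: "finite S" and finW: "finite W"
    using S(1) K W L by (auto simp: abstract_complex_def)
  have eq: "barycentric_map F \<alpha> w = (\<Sum>v\<in>S. \<alpha> v * barycentre (F v) w)" for w
    by (simp add: barycentric_map_def S_def)
  have "sum (barycentric_map F \<alpha>) W = (\<Sum>v\<in>S. \<Sum>w\<in>W. \<alpha> v * barycentre (F v) w)"
    unfolding eq by (rule sum.swap)
  also have "\<dots> = (\<Sum>v\<in>S. \<alpha> v * sum (barycentre (F v)) W)"
    by (simp add: sum_distrib_left)
  also have "\<dots> = (\<Sum>v\<in>S. \<alpha> v * 1)"
  proof (rule sum.cong)
    fix v assume "v \<in> S"
    then have "F v \<subseteq> W" "F v \<noteq> {}"
      using S(1) F(2) by (auto simp: W_def)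
    then show "\<alpha> v * sum (barycentre (F v)) W = \<alpha> v * 1"
      using sum_barycentre[OF finW] by simp
  qed simp
  finally have one: "sum (barycentric_map F \<alpha>) W = 1"
    using S(2) by simp
  have supp: "{w. barycentric_map F \<alpha> w \<noteq> 0} \<subseteq> W"
    unfolding W_def S_def by (rule support_barycentric_map)
  show ?thesis
    by (rule realization_pointsI[OF L W supp finW supp one])
      (auto simp: eq intro!: sum_nonneg mult_nonneg_nonneg nonneg barycentre_nonneg)
qed

lemma continuous_map_realizationI:
  assumes "finite_complex L"
    and "\<And>y. y \<in> S \<Longrightarrow> f y \<in> realization_points L"
    and "\<And>w. continuous_on S (\<lambda>y. f y w)"
  shows "continuous_map (top_of_set S) (realization L) f"
proof -
  have "continuous_on S f"
    using assms(3) by (rule continuous_on_coordinatewise_then_product)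
  then show ?thesis
    using assms(2) by (auto simp: realization_eq_top_of_set[OF assms(1)])
qed

lemma continuous_on_coordinate: "continuous_on S (\<lambda>\<alpha> :: 'v \<Rightarrow> real. \<alpha> v)"
  by (rule continuous_on_subset[OF continuous_on_product_coordinates]) simp

lemma continuous_map_barycentric_map:
  assumes K: "finite_complex K" and L: "finite_complex L"
    and F: "\<And>\<sigma>. \<sigma> \<in> K \<Longrightarrow> \<Union>(F ` \<sigma>) \<in> L" "\<And>v. v \<in> \<Union>K \<Longrightarrow> F v \<noteq> {}"
  shows "continuous_map (realization K) (realization L) (barycentric_map F)"
  unfolding realization_eq_top_of_set[OF K]
proof (rule continuous_map_realizationI[OF L])
  show "barycentric_map F \<alpha> \<in> realization_points L" if "\<alpha> \<in> realization_points K" for \<alpha>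
    using that K L F barycentric_map_in_realization_points[of K L F] by (auto simp: finite_complex_def)
  fix w
  have "continuous_on (realization_points K) (\<lambda>\<alpha>. \<Sum>v\<in>\<Union>K. \<alpha> v * barycentre (F v) w)"
    by (intro continuous_on_sum continuous_on_mult continuous_on_const continuous_on_coordinate)
  moreover have "barycentric_map F \<alpha> w = (\<Sum>v\<in>\<Union>K. \<alpha> v * barycentre (F v) w)"
    if "\<alpha> \<in> realization_points K" for \<alpha>
    using that by (intro barycentric_map_eq_sum finite_complex_vertices K)
      (auto simp: realization_points_def)
  ultimately show "continuous_on (realization_points K) (\<lambda>\<alpha>. barycentric_map F \<alpha> w)"
    by (simp cong: continuous_on_cong)
qed

lemma barycentric_map_singletons_comp:
  assumes "finite {v. \<alpha> v \<noteq> 0}"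
  shows "barycentric_map (\<lambda>w. {s w}) (barycentric_map (\<lambda>v. {f v}) \<alpha>) =
    barycentric_map (\<lambda>v. {s (f v)}) \<alpha>"
proof
  fix u
  define S where "S = {v. \<alpha> v \<noteq> 0}"
  let ?\<beta> = "barycentric_map (\<lambda>v. {f v}) \<alpha>"
  have fin: "finite S" "finite (f ` S)"
    using assms by (simp_all add: S_def)
  have supp: "{w. ?\<beta> w \<noteq> 0} \<subseteq> f ` S"
    using support_barycentric_map[of "\<lambda>v. {f v}" \<alpha>] by (auto simp: S_def)
  have "barycentric_map (\<lambda>w. {s w}) ?\<beta> u = (\<Sum>w\<in>f ` S. ?\<beta> w * barycentre {s w} u)"
    by (rule barycentric_map_eq_sum[OF fin(2) supp])
  also have "\<dots> = (\<Sum>w\<in>f ` S. \<Sum>v\<in>S. \<alpha> v * barycentre {f v} w * barycentre {s w} u)"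
    by (simp add: barycentric_map_def S_def sum_distrib_right)
  also have "\<dots> = (\<Sum>v\<in>S. \<Sum>w\<in>f ` S. \<alpha> v * barycentre {f v} w * barycentre {s w} u)"
    by (rule sum.swap)
  also have "\<dots> = (\<Sum>v\<in>S. \<alpha> v * barycentre {s (f v)} u)"
  proof (rule sum.cong)
    fix v assume v: "v \<in> S"
    have "(\<Sum>w\<in>f ` S. \<alpha> v * barycentre {f v} w * barycentre {s w} u) =
        (\<Sum>w\<in>f ` S. if w = f v then \<alpha> v * barycentre {s w} u else 0)"
      by (rule sum.cong) (auto simp: barycentre_def)
    then show "(\<Sum>w\<in>f ` S. \<alpha> v * barycentre {f v} w * barycentre {s w} u) =
        \<alpha> v * barycentre {s (f v)} u"
      using fin v by (simp add: sum.delta)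
  qed simp
  finally show "barycentric_map (\<lambda>w. {s w}) ?\<beta> u = barycentric_map (\<lambda>v. {s (f v)}) \<alpha> u"
    by (simp add: barycentric_map_def S_def)
qed

lemma barycentric_map_singletons_id:
  assumes "finite {v. \<alpha> v \<noteq> 0}" "\<And>v. \<alpha> v \<noteq> 0 \<Longrightarrow> f v = v"
  shows "barycentric_map (\<lambda>v. {f v}) \<alpha> = \<alpha>"
proof
  fix w
  have "barycentric_map (\<lambda>v. {f v}) \<alpha> w = (\<Sum>v | \<alpha> v \<noteq> 0. if v = w then \<alpha> v else 0)"
    unfolding barycentric_map_def by (rule sum.cong) (auto simp: assms(2) barycentre_def)
  then show "barycentric_map (\<lambda>v. {f v}) \<alpha> w = \<alpha> w"
    using assms(1) by (simp add: sum.delta')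
qed

section \<open>Order complexes\<close>

definition order_complex :: "'p set \<Rightarrow> ('p \<Rightarrow> 'p \<Rightarrow> bool) \<Rightarrow> 'p set set" where
  "order_complex P le =
     {C. C \<subseteq> P \<and> finite C \<and> C \<noteq> {} \<and> (\<forall>x\<in>C. \<forall>y\<in>C. le x y \<or> le y x)}"

lemma finite_complex_order_complex:
  assumes "finite P"
  shows "finite_complex (order_complex P le)"
proof -
  have "finite (order_complex P le)"
    by (rule finite_subset[of _ "Pow P"]) (use assms in \<open>auto simp: order_complex_def\<close>)
  moreover have "\<tau> \<in> order_complex P le"
    if "\<sigma> \<in> order_complex P le" "\<tau> \<noteq> {}" "\<tau> \<subseteq> \<sigma>" for \<sigma> \<tau>
    using that finite_subset[of \<tau> \<sigma>] unfolding order_complex_def by blast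
  moreover have "finite \<sigma> \<and> \<sigma> \<noteq> {}" if "\<sigma> \<in> order_complex P le" for \<sigma>
    using that by (simp add: order_complex_def)
  ultimately show ?thesis
    unfolding finite_complex_def abstract_complex_def by blast
qed

lemma order_complex_mono: "P \<subseteq> Q \<Longrightarrow> order_complex P le \<subseteq> order_complex Q le"
  by (auto simp: order_complex_def)

text \<open>
  Chains do not see the direction of the order; this lets one lemma serve for maps that move points
  down and for maps that move points up.
\<close>

lemma order_complex_dual: "order_complex P (\<lambda>x y. le y x) = order_complex P le"
  by (auto simp: order_complex_def)

lemma order_complex_image:
  assumes "C \<in> order_complex P le" and f: "\<And>x. x \<in> P \<Longrightarrow> f x \<in> Q"
    and mono: "\<And>x y. x \<in> P \<Longrightarrow> y \<in> P \<Longrightarrow> le x y \<Longrightarrow> le' (f x) (f y) \<or> le' (f y) (f x)"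
  shows "f ` C \<in> order_complex Q le'"
proof -
  have C: "C \<subseteq> P" "finite C" "C \<noteq> {}" "\<And>x y. x \<in> C \<Longrightarrow> y \<in> C \<Longrightarrow> le x y \<or> le y x"
    using assms(1) by (simp_all add: order_complex_def)
  have "le' (f x) (f y) \<or> le' (f y) (f x)" if "x \<in> C" "y \<in> C" for x y
    using C(1,4) mono that by blast
  then show ?thesis
    using C(1-3) f unfolding order_complex_def by blast
qed

section \<open>Homotopy equivalences\<close>

lemma homotopy_equivalence_compose:
  assumes "homotopy_equivalence X Y f" "homotopy_equivalence Y Z g"
  shows "homotopy_equivalence X Z (g \<circ> f)"
proof -
  obtain f' where f: "continuous_map X Y f" "continuous_map Y X f'"
      "homotopic_with (\<lambda>_. True) X X (f' \<circ> f) id" "homotopic_with (\<lambda>_. True) Y Y (f \<circ> f') id"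
    using assms(1) by (auto simp: homotopy_equivalence_def)
  obtain g' where g: "continuous_map Y Z g" "continuous_map Z Y g'"
      "homotopic_with (\<lambda>_. True) Y Y (g' \<circ> g) id" "homotopic_with (\<lambda>_. True) Z Z (g \<circ> g') id"
    using assms(2) by (auto simp: homotopy_equivalence_def)
  have "homotopic_with (\<lambda>_. True) X X (f' \<circ> (g' \<circ> g \<circ> f)) (f' \<circ> (id \<circ> f))"
    using f g by (intro homotopic_compose[of X Y _ _ X f' f'] homotopic_compose[of X Y f f Y])
      (simp_all add: homotopic_with_refl)
  then have "homotopic_with (\<lambda>_. True) X X ((f' \<circ> g') \<circ> (g \<circ> f)) id"
    using f(3) homotopic_with_trans by (fastforce simp: o_assoc)
  moreover have "homotopic_with (\<lambda>_. True) Z Z (g \<circ> (f \<circ> f' \<circ> g')) (g \<circ> (id \<circ> g'))"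
    using f g by (intro homotopic_compose[of Z Y _ _ Z g g] homotopic_compose[of Z Y g' g' Y])
      (simp_all add: homotopic_with_refl)
  then have "homotopic_with (\<lambda>_. True) Z Z ((g \<circ> f) \<circ> (f' \<circ> g')) id"
    using g(4) homotopic_with_trans by (fastforce simp: o_assoc)
  ultimately show ?thesis
    unfolding homotopy_equivalence_def
    using continuous_map_compose[OF f(1) g(1)] continuous_map_compose[OF g(2) f(2)] by blast
qed

section \<open>Barycentric subdivision\<close>

text \<open>
  Positive exactly when \<open>\<sigma>\<close> is cut out of the support of \<open>\<alpha>\<close> by a threshold: all coordinates in \<open>\<sigma>\<close>
  are positive and exceed all coordinates outside. The simplices with positive weight form a flag, and
  the weights are continuous in \<open>\<alpha>\<close>, so after normalization they are coordinates of a
  point of the barycentric subdivision.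
\<close>

definition superlevel_weight :: "'v set \<Rightarrow> ('v \<Rightarrow> real) \<Rightarrow> 'v set \<Rightarrow> real" where
  "superlevel_weight V \<alpha> \<sigma> =
     (\<Prod>x\<in>\<sigma>. \<alpha> x) * (\<Prod>x\<in>\<sigma>. \<Prod>y\<in>V - \<sigma>. max 0 (\<alpha> x - \<alpha> y))"

lemma superlevel_weight_nonneg:
  assumes "\<And>v. 0 \<le> \<alpha> v"
  shows "0 \<le> superlevel_weight V \<alpha> \<sigma>"
  unfolding superlevel_weight_def using assms by (simp add: prod_nonneg)

lemma superlevel_weight_nonzeroD:
  assumes "superlevel_weight V \<alpha> \<sigma> \<noteq> 0" "finite V" "\<sigma> \<subseteq> V" "x \<in> \<sigma>"
  shows "\<alpha> x \<noteq> 0" and "y \<in> V - \<sigma> \<Longrightarrow> \<alpha> y < \<alpha> x"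
proof -
  have fin: "finite \<sigma>" "finite (V - \<sigma>)"
    using assms(2,3) finite_subset by auto
  show "\<alpha> x \<noteq> 0"
    using assms(1,4) fin by (auto simp: superlevel_weight_def)
  assume "y \<in> V - \<sigma>"
  then have "max 0 (\<alpha> x - \<alpha> y) \<noteq> 0"
    using assms(1,4) fin by (auto simp: superlevel_weight_def)
  then show "\<alpha> y < \<alpha> x" by (simp split: if_splits add: max_def)
qed

lemma superlevel_weight_support:
  assumes "finite V" "{v. \<alpha> v \<noteq> 0} \<subseteq> V" "\<And>v. 0 \<le> \<alpha> v"
  shows "0 < superlevel_weight V \<alpha> {v. \<alpha> v \<noteq> 0}"
proof -
  have pos: "0 < \<alpha> x" if "\<alpha> x \<noteq> 0" for x
    using assms(3)[of x] that by simp
  have "0 < (\<Prod>x\<in>{v. \<alpha> v \<noteq> 0}. \<alpha> x)"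
    by (rule prod_pos) (simp add: pos)
  moreover have "0 < (\<Prod>x\<in>{v. \<alpha> v \<noteq> 0}. \<Prod>y\<in>V - {v. \<alpha> v \<noteq> 0}. max 0 (\<alpha> x - \<alpha> y))"
    by (intro prod_pos ballI) (simp add: pos)
  ultimately show ?thesis
    by (simp add: superlevel_weight_def)
qed

text \<open>
  A superlevel set \<open>\<sigma>\<close> separates large values of \<open>\<alpha>\<close> from small ones. If \<open>\<sigma>\<close> and \<open>\<rho>\<close> were
  incomparable, some \<open>x \<in> \<sigma> - \<rho>\<close> and \<open>y \<in> \<rho> - \<sigma>\<close> would have \<open>\<alpha> y < \<alpha> x\<close>, which the last
  hypothesis excludes.
\<close>

lemma superlevel_chain:
  assumes V: "finite V" "\<sigma> \<subseteq> V" "\<rho> \<subseteq> V" "superlevel_weight V \<alpha> \<sigma> \<noteq> 0"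
    and mono: "\<And>x y. x \<in> \<sigma> - \<rho> \<Longrightarrow> y \<in> \<rho> - \<sigma> \<Longrightarrow> \<alpha> x \<le> \<alpha> y"
  shows "\<sigma> \<subseteq> \<rho> \<or> \<rho> \<subseteq> \<sigma>"
proof (rule ccontr)
  assume "\<not> (\<sigma> \<subseteq> \<rho> \<or> \<rho> \<subseteq> \<sigma>)"
  then obtain x y where xy: "x \<in> \<sigma> - \<rho>" "y \<in> \<rho> - \<sigma>"
    by blast
  then have "\<alpha> y < \<alpha> x"
    using superlevel_weight_nonzeroD(2)[OF V(4,1,2), of x y] V(3) by blast
  then show False
    using mono[OF xy] by simp
qed

definition subdivide :: "'v set set \<Rightarrow> ('v \<Rightarrow> real) \<Rightarrow> 'v set \<Rightarrow> real" where
  "subdivide K \<alpha> \<sigma> = (if \<sigma> \<in> K then superlevel_weight (\<Union>K) \<alpha> \<sigma> else 0) /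
     (\<Sum>\<rho>\<in>K. superlevel_weight (\<Union>K) \<alpha> \<rho>)"

text \<open>
  The normalizing denominator does not vanish: the support of \<open>\<alpha>\<close> is itself a superlevel set.
\<close>

lemma sum_superlevel_weight_pos:
  assumes "finite_complex K" "\<alpha> \<in> realization_points K"
  shows "0 < (\<Sum>\<rho>\<in>K. superlevel_weight (\<Union>K) \<alpha> \<rho>)"
proof -
  have \<alpha>: "{v. \<alpha> v \<noteq> 0} \<in> K" "\<And>v. 0 \<le> \<alpha> v"
    using assms(2) by (simp_all add: realization_points_def)
  show ?thesis
  proof (rule sum_pos2[OF _ \<alpha>(1)])
    show "finite K" using assms(1) by (simp add: finite_complex_def)
    show "0 < superlevel_weight (\<Union>K) \<alpha> {v. \<alpha> v \<noteq> 0}"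
      using finite_complex_vertices[OF assms(1)] \<alpha> by (intro superlevel_weight_support) blast+
  qed (simp add: superlevel_weight_nonneg \<alpha>(2))
qed

lemma support_subdivide:
  "{\<sigma>. subdivide K \<alpha> \<sigma> \<noteq> 0} \<subseteq> {\<sigma> \<in> K. superlevel_weight (\<Union>K) \<alpha> \<sigma> \<noteq> 0}"
  by (auto simp: subdivide_def)

lemma superlevel_sets_below_support:
  assumes "finite_complex K" "\<sigma> \<in> K" "superlevel_weight (\<Union>K) \<alpha> \<sigma> \<noteq> 0"
  shows "\<sigma> \<subseteq> {v. \<alpha> v \<noteq> 0}"
proof
  fix x assume "x \<in> \<sigma>"
  then have "\<alpha> x \<noteq> 0"
    using superlevel_weight_nonzeroD(1)[OF assms(3) finite_complex_vertices[OF assms(1)] _ \<open>x \<in> \<sigma>\<close>]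
      assms(2) by blast
  then show "x \<in> {v. \<alpha> v \<noteq> 0}" by simp
qed

lemma superlevel_sets_chain:
  assumes K: "finite_complex K" and \<sigma>: "\<sigma> \<in> K" "superlevel_weight (\<Union>K) \<alpha> \<sigma> \<noteq> 0"
    and \<rho>: "\<rho> \<in> K" "superlevel_weight (\<Union>K) \<alpha> \<rho> \<noteq> 0"
  shows "\<sigma> \<subseteq> \<rho> \<or> \<rho> \<subseteq> \<sigma>"
proof (rule superlevel_chain[OF finite_complex_vertices[OF K] _ _ \<sigma>(2)])
  fix x y assume xy: "x \<in> \<sigma> - \<rho>" "y \<in> \<rho> - \<sigma>"
  have sub: "\<rho> \<subseteq> \<Union>K" using \<rho>(1) by blast
  have x: "x \<in> \<Union>K - \<rho>" using xy(1) \<sigma>(1) by blast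
  have y: "y \<in> \<rho>" using xy(2) by blast
  show "\<alpha> x \<le> \<alpha> y"
    using superlevel_weight_nonzeroD(2)[OF \<rho>(2) finite_complex_vertices[OF K] sub y x] by simp
qed (use \<sigma>(1) \<rho>(1) in blast)+

lemma subdivide_in_realization_points:
  assumes K: "finite_complex K" and \<alpha>: "\<alpha> \<in> realization_points K"
  shows "subdivide K \<alpha> \<in> realization_points (order_complex K (\<subseteq>))"
proof -
  let ?w = "superlevel_weight (\<Union>K) \<alpha>"
  let ?C = "{\<sigma> \<in> K. ?w \<sigma> \<noteq> 0}"
  have finK: "finite K" and acK: "abstract_complex (order_complex K (\<subseteq>))"
    using K finite_complex_order_complex[of K "(\<subseteq>)"] by (simp_all add: finite_complex_def)
  have nonneg: "0 \<le> ?w \<sigma>" for \<sigma>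
    using \<alpha> by (intro superlevel_weight_nonneg) (simp add: realization_points_def)
  have pos: "0 < (\<Sum>\<rho>\<in>K. ?w \<rho>)"
    by (rule sum_superlevel_weight_pos[OF K \<alpha>])
  have C: "?C \<in> order_complex K (\<subseteq>)"
  proof -
    have "?C \<noteq> {}"
    proof
      assume "?C = {}"
      then have "(\<Sum>\<rho>\<in>K. ?w \<rho>) = 0" by (intro sum.neutral) blast
      then show False using pos by simp
    qed
    moreover have "\<forall>\<sigma>\<in>?C. \<forall>\<rho>\<in>?C. \<sigma> \<subseteq> \<rho> \<or> \<rho> \<subseteq> \<sigma>"
      using superlevel_sets_chain[OF K] by blast
    ultimately show ?thesis
      using finK by (simp add: order_complex_def)
  qed
  have one: "sum (subdivide K \<alpha>) K = 1"
    using pos by (simp add: subdivide_def sum_divide_distrib[symmetric])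
  show ?thesis
  proof (rule realization_pointsI[OF acK C support_subdivide finK _ one])
    show "{\<sigma>. subdivide K \<alpha> \<sigma> \<noteq> 0} \<subseteq> K"
      by (auto simp: subdivide_def)
    show "0 \<le> subdivide K \<alpha> \<sigma>" for \<sigma>
      using nonneg pos by (simp add: subdivide_def)
  qed
qed

lemma continuous_map_subdivide:
  assumes K: "finite_complex K"
  shows "continuous_map (realization K) (realization (order_complex K (\<subseteq>))) (subdivide K)"
  unfolding realization_eq_top_of_set[OF K]
proof (rule continuous_map_realizationI)
  show "finite_complex (order_complex K (\<subseteq>))"
    using K by (intro finite_complex_order_complex) (simp add: finite_complex_def)
  show "subdivide K \<alpha> \<in> realization_points (order_complex K (\<subseteq>))" if "\<alpha> \<in> realization_points K" for \<alpha>
    by (rule subdivide_in_realization_points[OF K that])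
  fix \<sigma>
  have w: "continuous_on (realization_points K) (\<lambda>\<alpha>. superlevel_weight (\<Union>K) \<alpha> \<rho>)" for \<rho>
    unfolding superlevel_weight_def
    by (intro continuous_on_mult continuous_on_prod continuous_on_max continuous_on_diff
        continuous_on_const continuous_on_coordinate)
  have "continuous_on (realization_points K)
      (\<lambda>\<alpha>. (if \<sigma> \<in> K then superlevel_weight (\<Union>K) \<alpha> \<sigma> else 0) /
        (\<Sum>\<rho>\<in>K. superlevel_weight (\<Union>K) \<alpha> \<rho>))"
  proof (rule continuous_on_divide)
    show "continuous_on (realization_points K)
        (\<lambda>\<alpha>. if \<sigma> \<in> K then superlevel_weight (\<Union>K) \<alpha> \<sigma> else 0)"
      using w by (cases "\<sigma> \<in> K") simp_all
    show "continuous_on (realization_points K) (\<lambda>\<alpha>. \<Sum>\<rho>\<in>K. superlevel_weight (\<Union>K) \<alpha> \<rho>)"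
      by (rule continuous_on_sum) (rule w)
    show "\<forall>\<alpha>\<in>realization_points K. (\<Sum>\<rho>\<in>K. superlevel_weight (\<Union>K) \<alpha> \<rho>) \<noteq> 0"
      using sum_superlevel_weight_pos[OF K] by fastforce
  qed
  then show "continuous_on (realization_points K) (\<lambda>\<alpha>. subdivide K \<alpha> \<sigma>)"
    by (simp add: subdivide_def)
qed

lemma Union_flag:
  assumes K: "finite_complex K" and C: "C \<in> order_complex K (\<subseteq>)"
  shows "\<Union>C \<in> K"
proof -
  have "\<Union>C \<in> C"
    using C by (intro Union_in_chain[of C K]) (auto simp: order_complex_def subset_chain_def)
  then show ?thesis
    using C by (auto simp: order_complex_def)
qed

text \<open>
  The inverse only has to be correct up to homotopy, so \<open>subdivide\<close> may use any continuous weights that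
  are positive exactly on superlevel sets. Both homotopies are straight lines. Going from \<open>K\<close> to
  its subdivision and back leaves a point in its carrier, because superlevel sets lie inside the support. In the other
  direction, a point \<open>\<beta>\<close> carried by a flag \<open>C\<close> has an image whose coordinates are constant on the strata of
  \<open>C\<close> and do not increase from one stratum to the next larger one; therefore every superlevel set of the image is
  comparable with every member of \<open>C\<close>, and together they form a single flag.
\<close>

lemma barycentric_subdivision_homotopy_equivalence:
  assumes K: "finite_complex K"
  shows "homotopy_equivalence (realization (order_complex K (\<subseteq>))) (realization K)
           (barycentric_map (\<lambda>\<sigma>. \<sigma>))"
proof -
  let ?S = "order_complex K (\<subseteq>)" and ?b = "barycentric_map (\<lambda>\<sigma>. \<sigma>)"
  have finK: "finite K" and acK: "abstract_complex K"
    using K by (simp_all add: finite_complex_def)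
  have S: "finite_complex ?S"
    by (rule finite_complex_order_complex[OF finK])
  have in_K: "C \<subseteq> K" "finite C" "\<And>\<sigma> \<rho>. \<sigma> \<in> C \<Longrightarrow> \<rho> \<in> C \<Longrightarrow> \<sigma> \<subseteq> \<rho> \<or> \<rho> \<subseteq> \<sigma>" if "C \<in> ?S" for C
    using that by (simp_all add: order_complex_def)
  have nonempty: "\<sigma> \<noteq> {}" if "\<sigma> \<in> \<Union>?S" for \<sigma>
  proof -
    have "\<sigma> \<in> K" using that in_K(1) by blast
    then show ?thesis using acK by (simp add: abstract_complex_def)
  qed
  have b: "continuous_map (realization ?S) (realization K) ?b"
    using Union_flag[OF K] nonempty by (intro continuous_map_barycentric_map[OF S K]) simp_all
  have s: "continuous_map (realization K) (realization ?S) (subdivide K)"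
    by (rule continuous_map_subdivide[OF K])
  have "homotopic_with (\<lambda>_. True) (realization K) (realization K) (?b \<circ> subdivide K) id"
  proof (rule straight_line_homotopic[OF K K continuous_map_compose[OF s b] continuous_map_id])
    fix \<alpha> assume "\<alpha> \<in> realization_points K"
    then have \<alpha>: "{v. \<alpha> v \<noteq> 0} \<in> K"
      by (simp add: realization_points_def)
    have "{v. (?b \<circ> subdivide K) \<alpha> v \<noteq> 0} \<subseteq> \<Union>{\<sigma>. subdivide K \<alpha> \<sigma> \<noteq> 0}"
      using support_barycentric_map[of "\<lambda>\<sigma>. \<sigma>" "subdivide K \<alpha>"] by simp
    also have "\<dots> \<subseteq> {v. \<alpha> v \<noteq> 0}"
      using support_subdivide[of K \<alpha>] superlevel_sets_below_support[OF K] by blast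
    finally show "\<exists>\<sigma>\<in>K. {v. (?b \<circ> subdivide K) \<alpha> v \<noteq> 0} \<subseteq> \<sigma> \<and> {v. id \<alpha> v \<noteq> 0} \<subseteq> \<sigma>"
      using \<alpha> by (intro bexI[of _ "{v. \<alpha> v \<noteq> 0}"]) simp_all
  qed
  moreover have "homotopic_with (\<lambda>_. True) (realization ?S) (realization ?S) (subdivide K \<circ> ?b) id"
  proof (rule straight_line_homotopic[OF S S continuous_map_compose[OF b s] continuous_map_id])
    fix \<beta> assume \<beta>: "\<beta> \<in> realization_points ?S"
    define C where "C = {\<sigma>. \<beta> \<sigma> \<noteq> 0}"
    define D where "D = {\<sigma> \<in> K. superlevel_weight (\<Union>K) (?b \<beta>) \<sigma> \<noteq> 0}"
    have C: "C \<in> ?S" and nonneg: "0 \<le> \<beta> \<sigma>" for \<sigma>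
      using \<beta> by (simp_all add: realization_points_def C_def)
    have cross: "\<sigma> \<subseteq> \<rho> \<or> \<rho> \<subseteq> \<sigma>" if \<sigma>: "\<sigma> \<in> D" and \<rho>: "\<rho> \<in> C" for \<sigma> \<rho>
    proof (rule superlevel_chain[OF finite_complex_vertices[OF K]])
      show "\<sigma> \<subseteq> \<Union>K" "\<rho> \<subseteq> \<Union>K" "superlevel_weight (\<Union>K) (?b \<beta>) \<sigma> \<noteq> 0"
        using \<sigma> \<rho> in_K(1)[OF C] by (auto simp: D_def)
      fix x y assume x: "x \<in> \<sigma> - \<rho>" and y: "y \<in> \<rho> - \<sigma>"
      \<comment> \<open>A member of the flag that contains \<open>x\<close> is not inside \<open>\<rho>\<close>, so it contains \<open>\<rho>\<close> and with it \<open>y\<close>.\<close>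
      have "\<beta> \<tau> * barycentre \<tau> x \<le> \<beta> \<tau> * barycentre \<tau> y" if \<tau>: "\<tau> \<in> C" for \<tau>
      proof (cases "x \<in> \<tau>")
        case True
        then have "y \<in> \<tau>"
          using in_K(3)[OF C \<tau> \<rho>] x y by blast
        then show ?thesis
          using True by (simp add: barycentre_def)
      next
        case False
        then show ?thesis
          using nonneg by (simp add: barycentre_eq_0 barycentre_nonneg)
      qed
      then show "?b \<beta> x \<le> ?b \<beta> y"
        unfolding barycentric_map_def C_def[symmetric] by (rule sum_mono)
    qed
    have "C \<union> D \<in> ?S"
    proof -
      have "\<sigma> \<subseteq> \<rho> \<or> \<rho> \<subseteq> \<sigma>" if "\<sigma> \<in> C \<union> D" "\<rho> \<in> C \<union> D" for \<sigma> \<rho>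
        using that cross in_K(3)[OF C] superlevel_sets_chain[OF K] unfolding D_def by blast
      moreover have "C \<noteq> {}" "finite D" "D \<subseteq> K"
        using C finK by (auto simp: order_complex_def D_def)
      ultimately show ?thesis
        using in_K(1,2)[OF C] by (simp add: order_complex_def)
    qed
    moreover have "{\<sigma>. (subdivide K \<circ> ?b) \<beta> \<sigma> \<noteq> 0} \<subseteq> D"
      using support_subdivide[of K "?b \<beta>"] by (simp add: D_def)
    ultimately show "\<exists>E\<in>?S. {\<sigma>. (subdivide K \<circ> ?b) \<beta> \<sigma> \<noteq> 0} \<subseteq> E \<and> {\<sigma>. id \<beta> \<sigma> \<noteq> 0} \<subseteq> E"
      by (intro bexI[of _ "C \<union> D"]) (auto simp: C_def)
  qed
  ultimately show ?thesis
    unfolding homotopy_equivalence_def using b s by blast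
qed

section \<open>Order homotopies\<close>

definition mass_below :: "'p set \<Rightarrow> ('p \<Rightarrow> 'p \<Rightarrow> bool) \<Rightarrow> ('p \<Rightarrow> real) \<Rightarrow> 'p \<Rightarrow> real" where
  "mass_below P lt \<beta> p = (\<Sum>q | q \<in> P \<and> lt q p. \<beta> q)"

text \<open>
  A point \<open>\<beta>\<close> distributes mass 1 along a chain. At time \<open>t\<close> the lowest \<open>t\<close> units of that mass, counted
  from the bottom of the chain, have been moved; this is the part of them that sits at \<open>p\<close>.
\<close>

definition moved_mass :: "'p set \<Rightarrow> ('p \<Rightarrow> 'p \<Rightarrow> bool) \<Rightarrow> real \<Rightarrow> ('p \<Rightarrow> real) \<Rightarrow> 'p \<Rightarrow> real" where
  "moved_mass P lt t \<beta> p = max 0 (min (\<beta> p) (t - mass_below P lt \<beta> p))"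

lemma mass_below_nonneg: "(\<And>p. 0 \<le> \<beta> p) \<Longrightarrow> 0 \<le> mass_below P lt \<beta> p"
  by (simp add: mass_below_def sum_nonneg)

lemma mass_below_add:
  assumes "ordering le lt" "finite P" "p \<in> P" "\<And>q. 0 \<le> \<beta> q"
    and "\<And>q. q \<in> P \<Longrightarrow> lt q p \<Longrightarrow> q \<in> A" "p \<in> A" "A \<subseteq> P"
  shows "mass_below P lt \<beta> p + \<beta> p \<le> sum \<beta> A"
proof -
  interpret ordering le lt by (rule assms(1))
  have "\<not> lt p p"
    by (simp add: strict_iff_order)
  then have "mass_below P lt \<beta> p + \<beta> p = sum \<beta> (insert p {q \<in> P. lt q p})"
    using assms(2) by (simp add: mass_below_def)
  also have "\<dots> \<le> sum \<beta> A"
    using assms(4-7) finite_subset[OF assms(7,2)] by (intro sum_mono2) auto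
  finally show ?thesis .
qed

text \<open>
  The homotopy moves mass from \<open>p\<close> to \<open>\<phi> p\<close>, starting from the bottom of the chain. At time \<open>t\<close> the
  vertices that have lost mass lie weakly below those that still hold some, and at most one vertex is
  of both kinds. For \<open>a\<close> of the first kind and \<open>b\<close> of the second, \<open>\<phi> a \<le> a \<le> b\<close>; so the old and new
  vertices together form a chain. A straight line from the identity to the map would fail here, since
  \<open>\<phi> b\<close> and \<open>a\<close> need not be comparable when \<open>a < b\<close>.
\<close>

lemma homotopic_descent_map:
  assumes ord: "ordering le lt" and P: "finite P"
    and \<phi>: "\<And>p. p \<in> P \<Longrightarrow> \<phi> p \<in> P" "\<And>p. p \<in> P \<Longrightarrow> le (\<phi> p) p"
    and mono: "\<And>p q. p \<in> P \<Longrightarrow> q \<in> P \<Longrightarrow> le p q \<Longrightarrow> le (\<phi> p) (\<phi> q)"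
  shows "homotopic_with (\<lambda>_. True) (realization (order_complex P le)) (realization (order_complex P le))
           (barycentric_map (\<lambda>p. {\<phi> p})) id"
proof -
  interpret ordering le lt by (rule ord)
  let ?K = "order_complex P le"
  let ?m = "moved_mass P lt" and ?c = "mass_below P lt"
  let ?h = "\<lambda>(t, \<beta>) q. (\<Sum>p\<in>P. ?m t \<beta> p * barycentre {\<phi> p} q) + (\<beta> q - ?m t \<beta> q)"
  define S where "S = realization_points ?K"
  have K: "finite_complex ?K"
    by (rule finite_complex_order_complex[OF P])
  then have acK: "abstract_complex ?K"
    by (simp add: finite_complex_def)
  have pts: "{p. \<beta> p \<noteq> 0} \<in> ?K" "\<And>p. 0 \<le> \<beta> p" "{p. \<beta> p \<noteq> 0} \<subseteq> P" "sum \<beta> P = 1" if "\<beta> \<in> S" for \<beta>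
  proof -
    show 1: "{p. \<beta> p \<noteq> 0} \<in> ?K" and "\<And>p. 0 \<le> \<beta> p"
      using that by (simp_all add: S_def realization_points_def)
    show 2: "{p. \<beta> p \<noteq> 0} \<subseteq> P"
      using 1 by (simp add: order_complex_def)
    show "sum \<beta> P = 1"
      using that realization_points_sum[OF _ P 2] by (simp add: S_def)
  qed
  have "?h (t, \<beta>) \<in> realization_points ?K" if \<beta>: "\<beta> \<in> S" for t \<beta>
  proof -
    note b = pts[OF \<beta>]
    define C where "C = {p. \<beta> p \<noteq> 0}"
    define A where "A = {p \<in> C. ?c \<beta> p < t}"
    define B where "B = {p \<in> C. t < ?c \<beta> p + \<beta> p}"
    have C: "C \<in> ?K" "C \<subseteq> P" "finite C" "C \<noteq> {}" "\<And>p q. p \<in> C \<Longrightarrow> q \<in> C \<Longrightarrow> le p q \<or> le q p"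
      using b(1) by (simp_all add: order_complex_def C_def)
    have bnd: "0 \<le> ?m t \<beta> p" "?m t \<beta> p \<le> \<beta> p" for p
      using b(2)[of p] by (simp_all add: moved_mass_def)
    have out: "?m t \<beta> p = 0" if "p \<notin> A" for p
      using that b(2)[of p] by (auto simp: A_def C_def moved_mass_def)
    have stay: "?m t \<beta> p = \<beta> p" if "p \<notin> B" for p
      using that b(2)[of p] by (auto simp: B_def C_def moved_mass_def)
    \<comment> \<open>If \<open>b < a\<close>, all mass at \<open>b\<close> is counted before that at \<open>a\<close>, and so has gone before \<open>a\<close> is touched.\<close>
    have AB: "le a b" if "a \<in> A" "b \<in> B" for a b
    proof (rule ccontr)
      assume "\<not> le a b"
      then have ba: "lt b a"
        using C(5)[of a b] that strict_iff_order refl unfolding A_def B_def by blast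
      have "?c \<beta> b + \<beta> b \<le> sum \<beta> {q \<in> P. lt q a}"
        using ba that C(2) by (intro mass_below_add[OF ord P]) (auto simp: b B_def intro: strict_trans)
      also have "\<dots> = ?c \<beta> a"
        by (simp add: mass_below_def)
      finally show False
        using that by (simp add: A_def B_def)
    qed
    have D: "\<phi> ` A \<union> B \<in> ?K"
    proof -
      have sub: "A \<subseteq> P" "B \<subseteq> P" "A \<subseteq> C" "B \<subseteq> C"
        using C(2) by (auto simp: A_def B_def)
      have "le (\<phi> a) (\<phi> a') \<or> le (\<phi> a') (\<phi> a)" if "a \<in> A" "a' \<in> A" for a a'
        using C(5)[of a a'] mono[of a a'] mono[of a' a] that sub by blast
      moreover have "le (\<phi> a) b" if "a \<in> A" "b \<in> B" for a b
        by (rule trans[OF \<phi>(2) AB[OF that]]) (use that sub(1) in blast)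
      moreover have "le x y \<or> le y x" if "x \<in> B" "y \<in> B" for x y
        using C(5)[of x y] that sub(4) by blast
      ultimately have "\<forall>x\<in>\<phi> ` A \<union> B. \<forall>y\<in>\<phi> ` A \<union> B. le x y \<or> le y x"
        by blast
      moreover have "\<phi> ` A \<union> B \<subseteq> P" "finite (\<phi> ` A \<union> B)"
        using sub(1,2) \<phi>(1) finite_subset[OF sub(3) C(3)] finite_subset[OF sub(4) C(3)] by auto
      moreover have "\<phi> ` A \<union> B \<noteq> {}"
      proof -
        obtain p where "p \<in> C" using C(4) by blast
        moreover from this have "0 < \<beta> p"
          using b(2)[of p] by (simp add: C_def)
        ultimately have "p \<in> A \<or> p \<in> B"
          by (auto simp: A_def B_def)
        then show ?thesis by blast
      qed
      ultimately show ?thesis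
        by (simp add: order_complex_def)
    qed
    have supp: "{q. ?h (t, \<beta>) q \<noteq> 0} \<subseteq> \<phi> ` A \<union> B"
    proof
      fix q assume q: "q \<in> {q. ?h (t, \<beta>) q \<noteq> 0}"
      show "q \<in> \<phi> ` A \<union> B"
      proof (rule ccontr)
        assume no: "q \<notin> \<phi> ` A \<union> B"
        have "?m t \<beta> p * barycentre {\<phi> p} q = 0" for p
        proof (cases "p \<in> A")
          case True
          then have "q \<noteq> \<phi> p" using no by blast
          then show ?thesis by (simp add: barycentre_def)
        qed (simp add: out)
        then have "(\<Sum>p\<in>P. ?m t \<beta> p * barycentre {\<phi> p} q) = 0"
          by (intro sum.neutral) blast
        then show False
          using q stay[of q] no by simp
      qed
    qed
    have "sum (?h (t, \<beta>)) P =
        (\<Sum>q\<in>P. \<Sum>p\<in>P. ?m t \<beta> p * barycentre {\<phi> p} q) + (sum \<beta> P - sum (?m t \<beta>) P)"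
      by (simp add: sum.distrib sum_subtractf)
    also have "(\<Sum>q\<in>P. \<Sum>p\<in>P. ?m t \<beta> p * barycentre {\<phi> p} q) =
        (\<Sum>p\<in>P. ?m t \<beta> p * sum (barycentre {\<phi> p}) P)"
      by (subst sum.swap) (simp add: sum_distrib_left)
    also have "\<dots> = sum (?m t \<beta>) P"
      using sum_barycentre[OF P] \<phi>(1) by (intro sum.cong) simp_all
    finally have one: "sum (?h (t, \<beta>)) P = 1"
      using b(4) by simp
    show ?thesis
    proof (rule realization_pointsI[OF acK D supp P _ one])
      show "{q. ?h (t, \<beta>) q \<noteq> 0} \<subseteq> P"
        by (rule subset_trans[OF supp]) (use D in \<open>simp add: order_complex_def\<close>)
      show "0 \<le> ?h (t, \<beta>) q" for q
        using bnd by (auto intro!: add_nonneg_nonneg sum_nonneg mult_nonneg_nonneg barycentre_nonneg)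
    qed
  qed
  moreover have "continuous_on ({0..1} \<times> S) (\<lambda>z. ?h z q)" for q
  proof -
    have coord: "continuous_on ({0..1::real} \<times> S) (\<lambda>z. snd z p)" for p
      by (rule continuous_on_compose2[OF continuous_on_coordinate[of UNIV p] continuous_on_snd[OF continuous_on_id]]) simp
    have "continuous_on ({0..1::real} \<times> S) (\<lambda>z. ?m (fst z) (snd z) p)" for p
      unfolding moved_mass_def mass_below_def
      by (intro continuous_on_max continuous_on_min continuous_on_diff continuous_on_sum
          continuous_on_const continuous_on_fst continuous_on_id coord)
    then show ?thesis
      unfolding case_prod_unfold
      by (intro continuous_on_add continuous_on_diff continuous_on_sum continuous_on_mult
          continuous_on_const coord)
  qed
  ultimately have h: "continuous_map (top_of_set ({0..1} \<times> S)) (realization ?K) ?h"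
    by (intro continuous_map_realizationI[OF K]) auto
  have h0: "?h (0, \<beta>) = \<beta>" if "\<beta> \<in> S" for \<beta>
  proof -
    have "?m 0 \<beta> p = 0" for p
      using mass_below_nonneg[of \<beta> P lt p] pts(2)[OF that] by (simp add: moved_mass_def)
    then show ?thesis by simp
  qed
  have h1: "?h (1, \<beta>) = barycentric_map (\<lambda>p. {\<phi> p}) \<beta>" if "\<beta> \<in> S" for \<beta>
  proof -
    note b = pts[OF that]
    have "?m 1 \<beta> p = \<beta> p" for p
    proof (cases "p \<in> P")
      case True
      then have "?c \<beta> p + \<beta> p \<le> sum \<beta> P"
        by (intro mass_below_add[OF ord P]) (simp_all add: b)
      then show ?thesis
        using b(2)[of p] b(4) by (simp add: moved_mass_def)
    next
      case False
      then have "\<beta> p = 0" using b(3) by blast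
      then show ?thesis by (simp add: moved_mass_def)
    qed
    then show ?thesis
      by (simp add: fun_eq_iff barycentric_map_eq_sum[OF P b(3)])
  qed
  have "homotopic_with (\<lambda>_. True) (realization ?K) (realization ?K) id (barycentric_map (\<lambda>p. {\<phi> p}))"
    using h h0 h1
    by (subst homotopic_with) (auto simp: realization_eq_top_of_set[OF K] S_def intro!: exI[of _ ?h])
  then show ?thesis
    by (rule homotopic_with_symD)
qed

text \<open>
  The target may be any finite complex, since \<open>f\<close> and \<open>s\<close> enter only through the simplicial maps
  they induce. One composite is the identity on the nose, the other descends in the order.
\<close>

lemma vertex_retraction_homotopy_equivalence:
  assumes ord: "ordering le lt" and P: "finite P" and L: "finite_complex L"
    and f: "\<And>C. C \<in> order_complex P le \<Longrightarrow> f ` C \<in> L"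
    and s: "\<And>\<sigma>. \<sigma> \<in> L \<Longrightarrow> s ` \<sigma> \<in> order_complex P le"
    and fs: "\<And>w. w \<in> \<Union>L \<Longrightarrow> f (s w) = w"
    and sf: "\<And>p. p \<in> P \<Longrightarrow> le (s (f p)) p"
    and mono: "\<And>p q. p \<in> P \<Longrightarrow> q \<in> P \<Longrightarrow> le p q \<Longrightarrow> le (s (f p)) (s (f q))"
  shows "homotopy_equivalence (realization (order_complex P le)) (realization L)
           (barycentric_map (\<lambda>p. {f p}))"
proof -
  interpret ordering le lt by (rule ord)
  let ?K = "order_complex P le"
  let ?f = "barycentric_map (\<lambda>p. {f p})" and ?s = "barycentric_map (\<lambda>w. {s w})"
  have K: "finite_complex ?K"
    by (rule finite_complex_order_complex[OF P])
  have cf: "continuous_map (realization ?K) (realization L) ?f"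
    using f by (intro continuous_map_barycentric_map[OF K L]) (simp_all add: UNION_singleton_eq_range)
  have cs: "continuous_map (realization L) (realization ?K) ?s"
    using s by (intro continuous_map_barycentric_map[OF L K]) (simp_all add: UNION_singleton_eq_range)
  have inP: "s (f p) \<in> P" if "p \<in> P" for p
  proof -
    have "{p} \<in> ?K" using that refl by (simp add: order_complex_def)
    then have "s ` f ` {p} \<in> ?K" by (intro s f)
    then show ?thesis by (simp add: order_complex_def)
  qed
  have "homotopic_with (\<lambda>_. True) (realization ?K) (realization ?K)
      (barycentric_map (\<lambda>p. {s (f p)})) id"
    by (rule homotopic_descent_map[OF ord P inP sf mono])
  then have "homotopic_with (\<lambda>_. True) (realization ?K) (realization ?K) (?s \<circ> ?f) id"
  proof (rule homotopic_with_eq)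
    fix \<alpha> assume "\<alpha> \<in> topspace (realization ?K)"
    then have "finite {v. \<alpha> v \<noteq> 0}"
      by (simp add: topspace_realization realization_points_def order_complex_def)
    then show "(?s \<circ> ?f) \<alpha> = barycentric_map (\<lambda>p. {s (f p)}) \<alpha>"
      by (simp add: barycentric_map_singletons_comp)
  qed simp_all
  moreover have "homotopic_with (\<lambda>_. True) (realization L) (realization L) (?f \<circ> ?s) id"
  proof (rule homotopic_with_equal)
    fix \<alpha> assume "\<alpha> \<in> topspace (realization L)"
    then have \<alpha>: "{v. \<alpha> v \<noteq> 0} \<in> L"
      by (simp add: topspace_realization realization_points_def)
    then have "finite {v. \<alpha> v \<noteq> 0}"
      using L by (simp add: finite_complex_def abstract_complex_def)
    moreover have "f (s v) = v" if "\<alpha> v \<noteq> 0" for v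
      using \<alpha> that by (intro fs) blast
    ultimately show "(?f \<circ> ?s) \<alpha> = id \<alpha>"
      by (simp add: barycentric_map_singletons_comp barycentric_map_singletons_id)
  qed (use cf cs in \<open>auto intro: continuous_map_compose\<close>)
  ultimately show ?thesis
    unfolding homotopy_equivalence_def using cf cs by blast
qed

section \<open>Dowker pairs\<close>

definition common_neighbours :: "'a set \<Rightarrow> ('a \<Rightarrow> 'a \<Rightarrow> real) \<Rightarrow> real \<Rightarrow> 'a set \<Rightarrow> 'a set" where
  "common_neighbours X d r A = {y \<in> X. \<forall>x\<in>A. d x y \<le> r}"

definition dowker_pairs ::
    "'a set \<Rightarrow> ('a \<Rightarrow> 'a \<Rightarrow> real) \<Rightarrow> real \<Rightarrow> real \<Rightarrow> ('a set \<times> 'a set) set" where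
  "dowker_pairs X d m r = {(\<sigma>, \<tau>). \<sigma> \<subseteq> X \<and> \<sigma> \<noteq> {} \<and> \<tau> \<subseteq> X \<and>
     (\<forall>x\<in>\<sigma>. \<forall>y\<in>\<tau>. d x y \<le> r) \<and> m \<le> real (card \<tau>)}"

text \<open>
  Shrinking the second component makes the section \<open>\<sigma> \<mapsto> (\<sigma>, N(\<sigma>))\<close> monotone and \<open>\<tau> \<mapsto> (N(\<tau>), \<tau>)\<close>
  antitone, since \<open>N\<close> reverses inclusions.
\<close>

definition pair_le :: "'a set \<times> 'a set \<Rightarrow> 'a set \<times> 'a set \<Rightarrow> bool" where
  "pair_le p q \<longleftrightarrow> fst p \<subseteq> fst q \<and> snd q \<subseteq> snd p"

lemma ordering_pair_le: "ordering pair_le (\<lambda>p q. pair_le p q \<and> p \<noteq> q)"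
  by unfold_locales (auto simp: pair_le_def prod_eq_iff)

lemma ordering_pair_ge: "ordering (\<lambda>p q. pair_le q p) (\<lambda>p q. pair_le q p \<and> p \<noteq> q)"
  by unfold_locales (auto simp: pair_le_def prod_eq_iff)

lemma measure_dowker_count_space:
  assumes "finite X"
  shows "measure_dowker X d (count_space X) m (r / 2) =
    {\<sigma>. \<sigma> \<subseteq> X \<and> \<sigma> \<noteq> {} \<and> m \<le> real (card (common_neighbours X d r \<sigma>))}"
proof -
  have "emeasure (count_space X) {y \<in> X. \<forall>x\<in>\<sigma>. d x y \<le> 2 * (r / 2)} =
      ennreal (real (card (common_neighbours X d r \<sigma>)))" for \<sigma>
    using assms by (simp add: common_neighbours_def emeasure_count_space_finite ennreal_of_nat_eq_real_of_nat)
  then show ?thesis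
    unfolding measure_dowker_def using assms finite_subset by (auto simp: ennreal_le_iff)
qed

text \<open>
  The least member of a flag has at least \<open>m\<close> elements iff all its members do, so the condition on
  flags is a condition on vertices.
\<close>

lemma subdivision_filtration_eq_order_complex:
  assumes "abstract_complex K"
  shows "subdivision_filtration K m = order_complex {\<sigma> \<in> K. m \<le> real (card \<sigma>)} (\<subseteq>)"
proof (intro subset_antisym subsetI)
  fix C assume "C \<in> subdivision_filtration K m"
  then have C: "C \<subseteq> K" "finite C" "C \<noteq> {}" "\<forall>x\<in>C. \<forall>y\<in>C. x \<subseteq> y \<or> y \<subseteq> x"
      and m: "m \<le> real (card (\<Inter>C))"
    by (auto simp: subdivision_filtration_def barycentric_subdivision_def chains_def
        chain_subset_def simplex_dim_def)
  have "m \<le> real (card \<sigma>)" if "\<sigma> \<in> C" for \<sigma>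
  proof -
    have "finite \<sigma>"
      using C(1) assms that by (auto simp: abstract_complex_def)
    then have "card (\<Inter>C) \<le> card \<sigma>"
      using that by (intro card_mono) auto
    then show ?thesis
      using m by linarith
  qed
  then show "C \<in> order_complex {\<sigma> \<in> K. m \<le> real (card \<sigma>)} (\<subseteq>)"
    using C by (auto simp: order_complex_def)
next
  fix C assume "C \<in> order_complex {\<sigma> \<in> K. m \<le> real (card \<sigma>)} (\<subseteq>)"
  then have C: "C \<subseteq> {\<sigma> \<in> K. m \<le> real (card \<sigma>)}" "finite C" "C \<noteq> {}" "\<forall>x\<in>C. \<forall>y\<in>C. x \<subseteq> y \<or> y \<subseteq> x"
    by (simp_all add: order_complex_def)
  have "\<Inter>C \<in> C"
    using C by (intro Inter_in_chain[of C UNIV]) (auto simp: subset_chain_def)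
  then have "m \<le> real (card (\<Inter>C))"
    using C(1) by blast
  then show "C \<in> subdivision_filtration K m"
    using C by (auto simp: subdivision_filtration_def barycentric_subdivision_def chains_def
        chain_subset_def simplex_dim_def)
qed

lemma dowker_pairs_mono:
  assumes "m' \<le> m" "r \<le> r'"
  shows "dowker_pairs X d m r \<subseteq> dowker_pairs X d m' r'"
  using assms unfolding dowker_pairs_def by fastforce

lemma finite_dowker_pairs:
  assumes "finite X"
  shows "finite (dowker_pairs X d m r)"
  by (rule finite_subset[of _ "Pow X \<times> Pow X"]) (use assms in \<open>auto simp: dowker_pairs_def\<close>)

lemma finite_complex_measure_dowker:
  assumes "finite X"
  shows "finite_complex (measure_dowker X d (count_space X) m r)"
proof -
  have "finite (measure_dowker X d (count_space X) m r)"
    by (rule finite_subset[of _ "Pow X"]) (use assms in \<open>auto simp: measure_dowker_def\<close>)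
  then show ?thesis
    using abstract_complex_measure_dowker[of X d "count_space X" m r]
    by (simp add: finite_complex_def)
qed

lemma finite_complex_subdivision_filtration:
  assumes "finite X"
  shows "finite_complex (subdivision_filtration (intrinsic_cech X d r) m)"
  unfolding subdivision_filtration_eq_order_complex[OF abstract_complex_intrinsic_cech]
  by (rule finite_complex_order_complex, rule finite_subset[of _ "Pow X"])
    (use assms in \<open>auto simp: intrinsic_cech_def\<close>)

text \<open>
  The section \<open>\<sigma> \<mapsto> (\<sigma>, N(\<sigma>))\<close> picks the least pair over \<open>\<sigma>\<close>, because every partner \<open>\<tau>\<close> of \<open>\<sigma>\<close> is
  contained in \<open>N(\<sigma>)\<close>.
\<close>

lemma dowker_pairs_fst_equivalence:
  assumes X: "finite X"
  shows "homotopy_equivalence (realization (order_complex (dowker_pairs X d m r) pair_le))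
    (realization (measure_dowker X d (count_space X) m (r / 2)))
    (barycentric_map (\<lambda>\<sigma>. \<sigma>) \<circ> barycentric_map (\<lambda>p. {fst p}))"
proof (rule homotopy_equivalence_compose)
  let ?M = "measure_dowker X d (count_space X) m (r / 2)"
  let ?Q = "dowker_pairs X d m r"
  note M = measure_dowker_count_space[OF X, of d m r]
  let ?N = "common_neighbours X d r"
  have K: "finite_complex ?M"
    by (rule finite_complex_measure_dowker[OF X])
  then show "homotopy_equivalence (realization (order_complex ?M (\<subseteq>))) (realization ?M)
      (barycentric_map (\<lambda>\<sigma>. \<sigma>))"
    by (rule barycentric_subdivision_homotopy_equivalence)
  show "homotopy_equivalence (realization (order_complex ?Q pair_le))
      (realization (order_complex ?M (\<subseteq>))) (barycentric_map (\<lambda>p. {fst p}))"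
  proof (rule vertex_retraction_homotopy_equivalence[where s = "\<lambda>\<sigma>. (\<sigma>, ?N \<sigma>)", OF ordering_pair_le])
    show "finite ?Q" by (rule finite_dowker_pairs[OF X])
    show "finite_complex (order_complex ?M (\<subseteq>))"
      using K by (intro finite_complex_order_complex) (simp add: finite_complex_def)
    show "fst ` C \<in> order_complex ?M (\<subseteq>)" if "C \<in> order_complex ?Q pair_le" for C
      using that
    proof (rule order_complex_image)
      fix p assume "p \<in> ?Q"
      then have p: "fst p \<subseteq> X" "fst p \<noteq> {}" "snd p \<subseteq> ?N (fst p)" "m \<le> real (card (snd p))"
        by (auto simp: dowker_pairs_def common_neighbours_def)
      have "card (snd p) \<le> card (?N (fst p))"
        using p(3) X by (intro card_mono) (simp_all add: common_neighbours_def)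
      then show "fst p \<in> ?M"
        using p by (simp add: M)
    qed (simp add: pair_le_def)
    show "(\<lambda>\<sigma>. (\<sigma>, ?N \<sigma>)) ` C \<in> order_complex ?Q pair_le" if "C \<in> order_complex ?M (\<subseteq>)" for C
      using that
      by (rule order_complex_image) (auto simp: M dowker_pairs_def pair_le_def common_neighbours_def)
  qed (auto simp: pair_le_def dowker_pairs_def common_neighbours_def)
qed

text \<open>
  By symmetry of \<open>d\<close>, every partner \<open>\<sigma>\<close> of \<open>\<tau>\<close> is contained in \<open>N(\<tau>)\<close>, so \<open>\<tau> \<mapsto> (N(\<tau>), \<tau>)\<close> picks
  the greatest pair over \<open>\<tau>\<close>; in the opposite order it is the least. Positivity of \<open>m\<close> excludes the pairs
  with \<open>\<tau> = {}\<close>, which is not a simplex.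
\<close>

lemma dowker_pairs_snd_equivalence:
  assumes X: "Metric_space X d" "finite X" and m: "0 < m"
  shows "homotopy_equivalence (realization (order_complex (dowker_pairs X d m r) pair_le))
    (realization (subdivision_filtration (intrinsic_cech X d r) m))
    (barycentric_map (\<lambda>p. {snd p}))"
proof -
  interpret Metric_space X d by (rule X(1))
  let ?P = "{\<tau> \<in> intrinsic_cech X d r. m \<le> real (card \<tau>)}"
  let ?Q = "dowker_pairs X d m r"
  let ?N = "common_neighbours X d r"
  have "homotopy_equivalence (realization (order_complex ?Q (\<lambda>p q. pair_le q p)))
      (realization (order_complex ?P (\<subseteq>))) (barycentric_map (\<lambda>p. {snd p}))"
  proof (rule vertex_retraction_homotopy_equivalence[where s = "\<lambda>\<tau>. (?N \<tau>, \<tau>)", OF ordering_pair_ge])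
    show "finite ?Q" by (rule finite_dowker_pairs[OF X(2)])
    show "finite_complex (order_complex ?P (\<subseteq>))"
      using finite_complex_subdivision_filtration[OF X(2), of d r m]
      by (simp add: subdivision_filtration_eq_order_complex[OF abstract_complex_intrinsic_cech])
    show "snd ` C \<in> order_complex ?P (\<subseteq>)" if "C \<in> order_complex ?Q (\<lambda>p q. pair_le q p)" for C
      using that
    proof (rule order_complex_image)
      fix p assume "p \<in> ?Q"
      then have p: "fst p \<subseteq> X" "fst p \<noteq> {}" "\<forall>x\<in>fst p. \<forall>y\<in>snd p. d x y \<le> r"
          "snd p \<subseteq> X" "m \<le> real (card (snd p))"
        by (auto simp: dowker_pairs_def)
      have "snd p \<noteq> {}" using p(5) m by auto
      moreover have "finite (snd p)" using p(4) X(2) by (rule finite_subset)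
      moreover obtain x where x: "x \<in> fst p" using p(2) by blast
      then have "x \<in> X" "\<forall>y\<in>snd p. d y x \<le> r"
        using p(1,3) by (auto simp: commute)
      ultimately show "snd p \<in> ?P"
        using p(4,5) unfolding intrinsic_cech_def by blast
    qed (simp add: pair_le_def)
    show "(\<lambda>\<tau>. (?N \<tau>, \<tau>)) ` C \<in> order_complex ?Q (\<lambda>p q. pair_le q p)"
      if "C \<in> order_complex ?P (\<subseteq>)" for C
      using that
    proof (rule order_complex_image)
      fix \<tau> assume "\<tau> \<in> ?P"
      then show "(?N \<tau>, \<tau>) \<in> ?Q"
        by (auto simp: dowker_pairs_def common_neighbours_def intrinsic_cech_def commute)
    qed (auto simp: pair_le_def common_neighbours_def)
    show "pair_le p (?N (snd p), snd p)" if "p \<in> ?Q" for p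
      using that by (auto simp: pair_le_def dowker_pairs_def common_neighbours_def commute)
  qed (auto simp: pair_le_def common_neighbours_def)
  then show ?thesis
    unfolding order_complex_dual[of ?Q pair_le]
      subdivision_filtration_eq_order_complex[OF abstract_complex_intrinsic_cech] .
qed

section \<open>The zig-zag\<close>

text \<open>
  A single function that serves for all indices is automatically natural, as the structure maps
  are inclusions.
\<close>

lemma pointwise_equivalenceI:
  assumes "filtration P R F" "filtration P R G"
    and "\<And>p. p \<in> P \<Longrightarrow> homotopy_equivalence (F p) (G p) f"
  shows "pointwise_equivalence P R F G"
proof -
  have "natural_transformation P R F G (\<lambda>_. f)"
    using assms(3) by (auto simp: natural_transformation_def homotopy_equivalence_def)
  then show ?thesis
    unfolding pointwise_equivalence_def using assms by blast
qed

theorem corollary3p12: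
  fixes X :: "'a set" and d :: "'a \<Rightarrow> 'a \<Rightarrow> real"
  assumes "Metric_space X d" and "finite X"
  shows "weakly_equivalent TYPE('a set \<times> 'a set \<Rightarrow> real) index_set index_order
           (\<lambda>(m, r). realization (measure_dowker X d (count_space X) m (r / 2)))
           (\<lambda>(m, r). realization (subdivision_filtration (intrinsic_cech X d r) m))"
proof -
  let ?F = "\<lambda>(m, r). realization (measure_dowker X d (count_space X) m (r / 2))"
  let ?A = "\<lambda>(m, r). realization (order_complex (dowker_pairs X d m r) pair_le)"
  let ?G = "\<lambda>(m, r). realization (subdivision_filtration (intrinsic_cech X d r) m)"
  have F: "filtration index_set index_order ?F"
    unfolding case_prod_unfold
  proof (rule filtration_realization[OF partial_order_on_index])
    fix p q :: "real \<times> real" assume "(p, q) \<in> index_order"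
    then have le: "fst q \<le> fst p" "snd p \<le> snd q"
      by (auto simp: index_order_def)
    have "real (card (common_neighbours X d (snd p) \<sigma>)) \<le> real (card (common_neighbours X d (snd q) \<sigma>))" for \<sigma>
      using le(2) assms(2) unfolding common_neighbours_def of_nat_le_iff
      by (intro card_mono) (auto intro: order_trans)
    then show "measure_dowker X d (count_space X) (fst p) (snd p / 2) \<subseteq>
        measure_dowker X d (count_space X) (fst q) (snd q / 2)"
      using le(1) unfolding measure_dowker_count_space[OF assms(2)] by (blast intro: order_trans)
  qed (rule finite_complex_measure_dowker[OF assms(2)])
  have A: "filtration index_set index_order ?A"
    unfolding case_prod_unfold
  proof (rule filtration_realization[OF partial_order_on_index])
    fix p q :: "real \<times> real" assume "(p, q) \<in> index_order"
    then show "order_complex (dowker_pairs X d (fst p) (snd p)) pair_le \<subseteq>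
        order_complex (dowker_pairs X d (fst q) (snd q)) pair_le"
      by (intro order_complex_mono dowker_pairs_mono) (auto simp: index_order_def)
  qed (rule finite_complex_order_complex[OF finite_dowker_pairs[OF assms(2)]])
  have G: "filtration index_set index_order ?G"
    unfolding case_prod_unfold
  proof (rule filtration_realization[OF partial_order_on_index])
    fix p q :: "real \<times> real" assume "(p, q) \<in> index_order"
    then have le: "fst q \<le> fst p" "snd p \<le> snd q"
      by (auto simp: index_order_def)
    then have "intrinsic_cech X d (snd p) \<subseteq> intrinsic_cech X d (snd q)"
      unfolding intrinsic_cech_def by (blast intro: order_trans)
    then show "subdivision_filtration (intrinsic_cech X d (snd p)) (fst p) \<subseteq>
        subdivision_filtration (intrinsic_cech X d (snd q)) (fst q)"
      using le(1)
      unfolding subdivision_filtration_eq_order_complex[OF abstract_complex_intrinsic_cech]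
      by (intro order_complex_mono) auto
  qed (rule finite_complex_subdivision_filtration[OF assms(2)])
  have "pointwise_equivalence index_set index_order ?A ?F"
    by (rule pointwise_equivalenceI[OF A F, where f = "barycentric_map (\<lambda>\<sigma>. \<sigma>) \<circ> barycentric_map (\<lambda>p. {fst p})"])
      (auto intro: dowker_pairs_fst_equivalence[OF assms(2)])
  moreover have "pointwise_equivalence index_set index_order ?A ?G"
    by (rule pointwise_equivalenceI[OF A G, where f = "barycentric_map (\<lambda>p. {snd p})"])
      (auto simp: index_set_def intro: dowker_pairs_snd_equivalence[OF assms])
  \<comment> \<open>The middle filtration is both ends of an inner zig-zag of length zero.\<close>
  ultimately show ?thesis
    unfolding weakly_equivalent_def zigzag_step_def by blast
qed

end
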